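(* Let $Q(1)=\{(t,x)\in\mathbb{R}\times\mathbb{R}^{n+1}: x_1^2+\dots+x_{n+1}^2=1\}\subset\mathbb{L}^{n+2}$ be the static Einstein spacetime. The only compact stationary spacelike submanifolds in $Q(1)$ are the stationary submanifolds of a slice $\{t_0\}\times\mathbb{S}^n\equiv\mathbb{S}^n$.
   Context: $\mathbb{L}^{n+2}$ is $\mathbb{R}^{n+2}$ with coordinates $(t,x)=(t,x_1,\dots,x_{n+1})$ and the Lorentzian metric $-dt^2+dx_1^2+\dots+dx_{n+1}^2$. $Q(1)$, with the induced Lorentzian metric, is isometric to the static Einstein spacetime $\mathbb{R}\times\mathbb{S}^n$ with metric $-dt^2+g_{\mathbb{S}^n}$, where $\mathbb{S}^n$ is the $n$-dimensional unit round sphere. A slice of $Q(1)$ is a subset $\{t_0\}\times\mathbb{S}^n$ with $t_0\in\mathbb{R}$. A spacelike submanifold is an immersed submanifold whose induced metric is Riemannian. A submanifold is stationary in an ambient semi-Riemannian manifold if its mean curvature vector field (the normalized trace of its second fundamental form in that ambient manifold) vanishes identically.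
   Formalization: The submanifold is assumed connected (of dimension at least 1): a disjoint union of two different slices is compact, spacelike and stationary but lies in no single slice; for disconnected submanifolds the result applies to each component. *)

theory Defs
  imports "HOL-Analysis.Analysis"
begin

section \<open>Smooth functions on open sets\<close>

text \<open>Only used for open \<open>S\<close>, where it is \<open>C\<^sup>k\<close>-differentiability.\<close>

primrec Ck_on :: "nat \<Rightarrow> 'e::euclidean_space set \<Rightarrow> ('e \<Rightarrow> 'f::real_normed_vector) \<Rightarrow> bool" where
  "Ck_on 0 S f \<longleftrightarrow> continuous_on S f"
| "Ck_on (Suc k) S f \<longleftrightarrow>
     f differentiable_on S \<and> (\<forall>v. Ck_on k S (\<lambda>x. frechet_derivative f (at x) v))"

definition smooth_on :: "'e::euclidean_space set \<Rightarrow> ('e \<Rightarrow> 'f::real_normed_vector) \<Rightarrow> bool" where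
  "smooth_on S f \<longleftrightarrow> (\<forall>k. Ck_on k S f)"

definition partial :: "'k::finite \<Rightarrow> (real^'k \<Rightarrow> 'f::real_normed_vector) \<Rightarrow> real^'k \<Rightarrow> 'f" where
  "partial i f x = frechet_derivative f (at x) (axis i 1)"


section \<open>Manifolds and smooth maps\<close>

text \<open>A chart is a domain together with a coordinate map; the values of the coordinate map
  outside the domain are irrelevant.\<close>

type_synonym ('a, 'k) chart = "'a set \<times> ('a \<Rightarrow> real^'k)"

definition param :: "('a, 'k::finite) chart \<Rightarrow> real^'k \<Rightarrow> 'a" where
  "param c = inv_into (fst c) (snd c)"

definition loc_dom :: "('a \<Rightarrow> 'b) \<Rightarrow> ('a, 'm::finite) chart \<Rightarrow> ('b, 'k::finite) chart \<Rightarrow> (real^'m) set" where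
  "loc_dom f c d = snd c ` (fst c \<inter> f -` fst d)"

definition loc_rep :: "('a \<Rightarrow> 'b) \<Rightarrow> ('a, 'm::finite) chart \<Rightarrow> ('b, 'k::finite) chart \<Rightarrow> real^'m \<Rightarrow> real^'k" where
  "loc_rep f c d = snd d \<circ> f \<circ> param c"

record ('a, 'k::finite) manifold =
  mtop :: "'a topology"
  atlas :: "('a, 'k) chart set"

definition smooth_manifold :: "('a, 'k::finite, 'z) manifold_scheme \<Rightarrow> bool" where
  "smooth_manifold M \<longleftrightarrow>
     Hausdorff_space (mtop M) \<and> second_countable (mtop M) \<and>
     \<Union> (fst ` atlas M) = topspace (mtop M) \<and>
     (\<forall>c\<in>atlas M. openin (mtop M) (fst c) \<and> open (snd c ` fst c) \<and>
        homeomorphic_map (subtopology (mtop M) (fst c)) (top_of_set (snd c ` fst c)) (snd c)) \<and>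
     (\<forall>c\<in>atlas M. \<forall>d\<in>atlas M. smooth_on (loc_dom id c d) (loc_rep id c d))"

definition smooth_map ::
  "('a, 'm::finite, 'y) manifold_scheme \<Rightarrow> ('b, 'k::finite, 'z) manifold_scheme \<Rightarrow> ('a \<Rightarrow> 'b) \<Rightarrow> bool" where
  "smooth_map M N f \<longleftrightarrow>
     continuous_map (mtop M) (mtop N) f \<and>
     (\<forall>c\<in>atlas M. \<forall>d\<in>atlas N. smooth_on (loc_dom f c d) (loc_rep f c d))"

definition immersion ::
  "('a, 'm::finite, 'y) manifold_scheme \<Rightarrow> ('b, 'k::finite, 'z) manifold_scheme \<Rightarrow> ('a \<Rightarrow> 'b) \<Rightarrow> bool" where
  "immersion M N f \<longleftrightarrow>
     smooth_map M N f \<and>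
     (\<forall>c\<in>atlas M. \<forall>d\<in>atlas N. \<forall>x\<in>loc_dom f c d. inj (frechet_derivative (loc_rep f c d) (at x)))"


section \<open>Submanifolds of a semi-Riemannian manifold\<close>

text \<open>\<open>metric N d y v w\<close> is the metric of \<open>N\<close> at the point with coordinates \<open>y\<close> in the chart
  \<open>d\<close>, applied to the tangent vectors with components \<open>v\<close> and \<open>w\<close> in that chart.  All tangent
  vectors of \<open>N\<close> below are likewise given by their components in \<open>d\<close>.\<close>

record ('a, 'k::finite) semi_riemannian = "('a, 'k) manifold" +
  metric :: "('a, 'k) chart \<Rightarrow> real^'k \<Rightarrow> real^'k \<Rightarrow> real^'k \<Rightarrow> real"

definition gram :: "(real^'k \<Rightarrow> real^'k \<Rightarrow> real) \<Rightarrow> real^'k^'k::finite" where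
  "gram b = (\<chi> i j. b (axis i 1) (axis j 1))"

text \<open>The Christoffel symbols \<open>\<Gamma>\<^sup>e\<^sub>a\<^sub>b\<close> of the Levi-Civita connection.\<close>

definition christoffel ::
  "('b, 'k::finite, 'z) semi_riemannian_scheme \<Rightarrow> ('b, 'k) chart \<Rightarrow> real^'k \<Rightarrow> 'k \<Rightarrow> 'k \<Rightarrow> 'k \<Rightarrow> real" where
  "christoffel N d y e a b =
     (let G = (\<lambda>z. gram (metric N d z)) in
      1 / 2 * (\<Sum>h\<in>UNIV. matrix_inv (G y) $ e $ h *
        (partial a (\<lambda>z. G z $ b $ h) y + partial b (\<lambda>z. G z $ a $ h) y
         - partial h (\<lambda>z. G z $ a $ b) y)))"

definition induced_metric ::
  "('b, 'k::finite, 'z) semi_riemannian_scheme \<Rightarrow> ('a \<Rightarrow> 'b) \<Rightarrow> ('a, 'm::finite) chart \<Rightarrow> ('b, 'k) chart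
   \<Rightarrow> real^'m \<Rightarrow> real^'m \<Rightarrow> real^'m \<Rightarrow> real" where
  "induced_metric N f c d x v w =
     (let u = loc_rep f c d; Du = frechet_derivative u (at x)
      in metric N d (u x) (Du v) (Du w))"

definition spacelike_submanifold ::
  "('a, 'm::finite, 'y) manifold_scheme \<Rightarrow> ('b, 'k::finite, 'z) semi_riemannian_scheme \<Rightarrow> ('a \<Rightarrow> 'b) \<Rightarrow> bool" where
  "spacelike_submanifold M N f \<longleftrightarrow>
     immersion M N f \<and>
     (\<forall>c\<in>atlas M. \<forall>d\<in>atlas N. \<forall>x\<in>loc_dom f c d. \<forall>v. v \<noteq> 0 \<longrightarrow> induced_metric N f c d x v v > 0)"

text \<open>The covariant derivative in \<open>N\<close> of the coordinate field \<open>df(\<partial>\<^sub>j)\<close> along \<open>\<partial>\<^sub>i\<close>.\<close>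

definition cov_deriv ::
  "('b, 'k::finite, 'z) semi_riemannian_scheme \<Rightarrow> ('a \<Rightarrow> 'b) \<Rightarrow> ('a, 'm::finite) chart \<Rightarrow> ('b, 'k) chart
   \<Rightarrow> real^'m \<Rightarrow> 'm \<Rightarrow> 'm \<Rightarrow> real^'k" where
  "cov_deriv N f c d x i j =
     (let u = loc_rep f c d in
      \<chi> e. partial i (partial j u) x $ e +
        (\<Sum>a\<in>UNIV. \<Sum>b\<in>UNIV. christoffel N d (u x) e a b * partial i u x $ a * partial j u x $ b))"

text \<open>The component of \<open>w\<close> that is metrically orthogonal to the image of \<open>df\<close>.\<close>

definition normal_part ::
  "('b, 'k::finite, 'z) semi_riemannian_scheme \<Rightarrow> ('a \<Rightarrow> 'b) \<Rightarrow> ('a, 'm::finite) chart \<Rightarrow> ('b, 'k) chart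
   \<Rightarrow> real^'m \<Rightarrow> real^'k \<Rightarrow> real^'k" where
  "normal_part N f c d x w =
     (let u = loc_rep f c d; g = gram (induced_metric N f c d x) in
      w - (\<Sum>i\<in>UNIV. \<Sum>j\<in>UNIV.
             (matrix_inv g $ i $ j * metric N d (u x) w (partial j u x)) *\<^sub>R partial i u x))"

definition second_fundamental_form ::
  "('b, 'k::finite, 'z) semi_riemannian_scheme \<Rightarrow> ('a \<Rightarrow> 'b) \<Rightarrow> ('a, 'm::finite) chart \<Rightarrow> ('b, 'k) chart
   \<Rightarrow> real^'m \<Rightarrow> 'm \<Rightarrow> 'm \<Rightarrow> real^'k" where
  "second_fundamental_form N f c d x i j = normal_part N f c d x (cov_deriv N f c d x i j)"

definition mean_curvature ::
  "('b, 'k::finite, 'z) semi_riemannian_scheme \<Rightarrow> ('a \<Rightarrow> 'b) \<Rightarrow> ('a, 'm::finite) chart \<Rightarrow> ('b, 'k) chart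
   \<Rightarrow> real^'m \<Rightarrow> real^'k" where
  "mean_curvature N f c d x =
     (let g = gram (induced_metric N f c d x) in
      (1 / real CARD('m)) *\<^sub>R
        (\<Sum>i\<in>UNIV. \<Sum>j\<in>UNIV. matrix_inv g $ i $ j *\<^sub>R second_fundamental_form N f c d x i j))"

text \<open>Only meaningful for immersions with nondegenerate induced metric, since it uses the inverse
  of the first fundamental form.\<close>

definition stationary ::
  "('a, 'm::finite, 'y) manifold_scheme \<Rightarrow> ('b, 'k::finite, 'z) semi_riemannian_scheme \<Rightarrow> ('a \<Rightarrow> 'b) \<Rightarrow> bool" where
  "stationary M N f \<longleftrightarrow>
     (\<forall>c\<in>atlas M. \<forall>d\<in>atlas N. \<forall>x\<in>loc_dom f c d. mean_curvature N f c d x = 0)"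


section \<open>The static Einstein spacetime and its slices\<close>

text \<open>The Lorentzian metric of \<open>\<real> \<times> \<real>\<^sup>d\<close>.\<close>

definition lorentz :: "real \<times> (real^'d) \<Rightarrow> real \<times> (real^'d) \<Rightarrow> real" where
  "lorentz v w = - (fst v * fst w) + snd v \<bullet> snd w"

text \<open>A \<open>k\<close>-dimensional embedded submanifold \<open>S\<close> with the metric induced from \<open>lorentz\<close>.  The
  atlas is maximal: it consists of the inverses of all regular local parametrizations of \<open>S\<close>.\<close>

definition lorentz_submanifold ::
  "(real \<times> (real^'d)) set \<Rightarrow> (real \<times> (real^'d), 'k::finite) semi_riemannian" where
  "lorentz_submanifold S =
     \<lparr> mtop = top_of_set S,
       atlas = {c. openin (top_of_set S) (fst c) \<and> open (snd c ` fst c) \<and>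
                   homeomorphism (fst c) (snd c ` fst c) (snd c) (param c) \<and>
                   smooth_on (snd c ` fst c) (param c) \<and>
                   (\<forall>y\<in>snd c ` fst c. inj (frechet_derivative (param c) (at y)))},
       metric = (\<lambda>c y v w. lorentz (frechet_derivative (param c) (at y) v)
                                   (frechet_derivative (param c) (at y) w)) \<rparr>"

text \<open>With \<open>d = n + 1\<close> space coordinates, \<open>Q(1)\<close> has dimension \<open>d\<close>, so that its charts take
  values in \<open>real^'d\<close>; a slice is an \<open>n\<close>-sphere and has charts in \<open>real^'n\<close>.\<close>

definition static_einstein :: "(real \<times> (real^'d), 'd::finite) semi_riemannian" where
  "static_einstein = lorentz_submanifold {(t, x). (\<Sum>i\<in>UNIV. (x $ i)\<^sup>2) = 1}"

definition slice :: "real \<Rightarrow> (real \<times> (real^'d), 'n::finite) semi_riemannian" where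
  "slice t0 = lorentz_submanifold ({t0} \<times> {x. (\<Sum>i\<in>UNIV. (x $ i)\<^sup>2) = 1})"

end

(* Let F be a local parametrization of the submanifold, viewed in Minkowski space, and g its first
   fundamental form. The covariant derivative of Q(1) is the tangential projection of the flat one, so
   the submanifold is stationary iff the component of g^ij F_ij normal to the submanifold is orthogonal
   to the tangent space of Q(1). Since Q(1) is a product, d/dt is tangent to it; testing with d/dt shows
   that the time coordinate is harmonic, hence constant on a compact connected M by E. Hopf's strong
   maximum principle. Conversely, inside a slice all time components vanish, so the stationarity
   conditions for the slice and for Q(1) coincide. *)
theory Submission
  imports Defs
begin

section \<open>Calculus of \<open>C\<^sup>k\<close> functions\<close>

text \<open>Smoothness, metric and curvature are defined through ambient charts, and the charts of
  Q(1) and of a slice take values in spaces of different dimension. All notions are therefore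
  rewritten in terms of \<open>\<psi> \<circ> param c\<close>, a map into the one Minkowski space;
  the two ambient manifolds then differ only in their point sets and tangent spaces. The obstacle is
  that an ambient chart \<open>d\<close> is known to be smooth only through its inverse
  \<open>param d\<close>, so a smooth map into Minkowski space has to be lifted through an
  immersion, and even the differentiability of the lift needs a proof. The maximum principle is
  local and needs no integration over \<open>M\<close>, but it needs coefficients bounded on compact
  balls, hence continuity of the inverse of the first fundamental form, which Cramer's rule
  supplies. It compares the time with exp(-\<alpha> |y - z|^2): for large \<alpha> the second-order
  terms of this function, of size \<alpha>^2, dominate the remaining ones.\<close>

lemma Ck_on_cong_imp:
  assumes "open S" "\<And>x. x \<in> S \<Longrightarrow> f x = g x" "Ck_on k S f"
  shows "Ck_on k S g"
  using assms(2,3)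
proof (induction k arbitrary: f g)
  case 0
  then show ?case by (simp cong: continuous_on_cong)
next
  case (Suc k)
  have d: "f differentiable at x" if "x \<in> S" for x
    using Suc.prems(2) that \<open>open S\<close> by (simp add: differentiable_on_eq_differentiable_at)
  have "g differentiable_on S"
    using Suc.prems(1,2) by (simp add: differentiable_on_def differentiable_def)
      (metis has_derivative_transform)
  have "frechet_derivative f (at x) = frechet_derivative g (at x)" if "x \<in> S" for x
    using frechet_derivative_transform_within_open[OF d[OF that] \<open>open S\<close> that] Suc.prems(1) by blast
  then have *: "x \<in> S \<Longrightarrow> frechet_derivative f (at x) v = frechet_derivative g (at x) v" for x v
    by simp
  have "Ck_on k S (\<lambda>x. frechet_derivative g (at x) v)" for v
    by (rule Suc.IH[OF *]) (use Suc.prems(2) in simp_all)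
  with \<open>g differentiable_on S\<close> show ?case by simp
qed

text \<open>Derivatives are unique, so any explicit derivative \<open>f'\<close> may stand for the
  chosen \<open>frechet_derivative\<close>; the closure rules below rest on this.\<close>

lemma Ck_on_SucI:
  assumes "open S" "\<And>x. x \<in> S \<Longrightarrow> (f has_derivative f' x) (at x)" "\<And>v. Ck_on k S (\<lambda>x. f' x v)"
  shows "Ck_on (Suc k) S f"
proof -
  have "f' x v = frechet_derivative f (at x) v" if "x \<in> S" for x v
    using frechet_derivative_at[OF assms(2)[OF that]] by simp
  then have "Ck_on k S (\<lambda>x. frechet_derivative f (at x) v)" for v
    using assms by (auto intro: Ck_on_cong_imp[OF assms(1) _ assms(3)])
  moreover have "f differentiable_on S"
    using assms(2) differentiableI differentiable_at_withinI unfolding differentiable_on_def by blast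
  ultimately show ?thesis by simp
qed

lemma Ck_on_Suc_has_derivative:
  assumes "Ck_on (Suc k) S f" "open S" "x \<in> S"
  shows "(f has_derivative frechet_derivative f (at x)) (at x)"
  using assms by (simp add: differentiable_on_eq_differentiable_at frechet_derivative_works)

lemma Ck_on_lower: "Ck_on (Suc k) S f \<Longrightarrow> Ck_on k S f"
proof (induction k arbitrary: f)
  case 0
  then show ?case by (simp add: differentiable_imp_continuous_on)
next
  case (Suc k)
  have "Ck_on k S (\<lambda>x. frechet_derivative f (at x) v)" for v
    by (rule Suc.IH) (use Suc.prems in simp)
  with Suc.prems show ?case by simp
qed

lemma Ck_on_subset: "Ck_on k S f \<Longrightarrow> T \<subseteq> S \<Longrightarrow> Ck_on k T f"
proof (induction k arbitrary: f)
  case 0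
  then show ?case by (simp add: continuous_on_subset)
next
  case (Suc k)
  then have "f differentiable_on T" by (meson Ck_on.simps(2) differentiable_on_subset)
  moreover have "Ck_on k T (\<lambda>x. frechet_derivative f (at x) v)" for v
    using Suc by simp
  ultimately show ?case by simp
qed

text \<open>Derivatives are taken at the full neighbourhood filter, so the property is local. This
  lets smoothness on a chart of \<open>M\<close> be checked one ambient chart at a time.\<close>

lemma Ck_on_local:
  assumes "\<And>x. x \<in> S \<Longrightarrow> \<exists>T. open T \<and> x \<in> T \<and> Ck_on k T f"
  shows "Ck_on k S f"
  using assms
proof (induction k arbitrary: f)
  case 0
  show ?case
    unfolding Ck_on.simps
  proof (rule continuous_at_imp_continuous_on, rule ballI)
    fix x assume "x \<in> S"
    then obtain T where "open T" "x \<in> T" "continuous_on T f" using 0[of x] by auto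
    then show "isCont f x" by (simp add: continuous_on_eq_continuous_at)
  qed
next
  case (Suc k)
  have "f differentiable_on S"
    unfolding differentiable_on_def
  proof
    fix x assume "x \<in> S"
    then obtain T where "open T" "x \<in> T" "Ck_on (Suc k) T f" using Suc.prems[of x] by blast
    then have "f differentiable at x"
      using differentiableI[OF Ck_on_Suc_has_derivative] by blast
    then show "f differentiable at x within S" by (rule differentiable_at_withinI)
  qed
  moreover have "Ck_on k S (\<lambda>x. frechet_derivative f (at x) v)" for v
  proof (rule Suc.IH)
    fix x assume "x \<in> S"
    then obtain T where "open T" "x \<in> T" "Ck_on (Suc k) T f" using Suc.prems[of x] by blast
    then show "\<exists>T. open T \<and> x \<in> T \<and> Ck_on k T (\<lambda>x. frechet_derivative f (at x) v)"
      by (intro exI[of _ T]) simp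
  qed
  ultimately show ?case by simp
qed

lemma Ck_on_const [intro, simp]: "open S \<Longrightarrow> Ck_on k S (\<lambda>x. c)"
proof (induction k arbitrary: c)
  case (Suc k)
  then show ?case by (auto intro!: Ck_on_SucI[where f' = "\<lambda>x v. 0"] simp del: Ck_on.simps)
qed auto

lemma Ck_on_linear_compose:
  assumes "bounded_linear L" "open S" "Ck_on k S f"
  shows "Ck_on k S (\<lambda>x. L (f x))"
  using assms(3)
proof (induction k arbitrary: f)
  case 0
  then show ?case using assms(1) by (simp add: bounded_linear.continuous_on)
next
  case (Suc k)
  have "Ck_on k S (\<lambda>x. L (frechet_derivative f (at x) v))" for v
    by (rule Suc.IH) (use Suc.prems in simp)
  then show ?case
    using bounded_linear.has_derivative[OF assms(1) Ck_on_Suc_has_derivative[OF Suc.prems assms(2)]]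
    by (intro Ck_on_SucI[OF assms(2), where f' = "\<lambda>x v. L (frechet_derivative f (at x) v)"])
qed

lemma Ck_on_add:
  assumes "open S" "Ck_on k S f" "Ck_on k S g"
  shows "Ck_on k S (\<lambda>x. f x + g x)"
  using assms(2,3)
proof (induction k arbitrary: f g)
  case 0
  then show ?case by (simp add: continuous_on_add)
next
  case (Suc k)
  have "Ck_on k S (\<lambda>x. frechet_derivative f (at x) v + frechet_derivative g (at x) v)" for v
    by (rule Suc.IH) (use Suc.prems in simp_all)
  then show ?case
    using Ck_on_Suc_has_derivative[OF Suc.prems(1) assms(1)] Ck_on_Suc_has_derivative[OF Suc.prems(2) assms(1)]
    by (intro Ck_on_SucI[OF assms(1), where f' = "\<lambda>x v. frechet_derivative f (at x) v + frechet_derivative g (at x) v"]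
         has_derivative_add)
qed

lemma Ck_on_sum:
  assumes "open S" "\<And>i. i \<in> I \<Longrightarrow> Ck_on k S (f i)"
  shows "Ck_on k S (\<lambda>x. \<Sum>i\<in>I. f i x)"
  using assms(2)
proof (induction I rule: infinite_finite_induct)
  case (insert i I)
  show ?case
    unfolding sum.insert[OF insert.hyps] by (intro Ck_on_add assms(1) insert.IH insert.prems) simp_all
qed (simp_all add: assms(1) del: Ck_on.simps)

text \<open>The Leibniz rule gives products of one differentiated and one undifferentiated factor;
  \<open>Ck_on_lower\<close> brings the latter down to order \<open>k\<close>.\<close>

lemma Ck_on_bilinear:
  assumes "bounded_bilinear p" "open S" "Ck_on k S f" "Ck_on k S g"
  shows "Ck_on k S (\<lambda>x. p (f x) (g x))"
  using assms(3,4)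
proof (induction k arbitrary: f g)
  case 0
  then show ?case using bounded_bilinear.continuous_on[OF assms(1)] by simp
next
  case (Suc k)
  have IH: "Ck_on k S (\<lambda>x. p (f x) (frechet_derivative g (at x) v) + p (frechet_derivative f (at x) v) (g x))" for v
    using Suc.prems(1,2)[THEN Ck_on_lower] Suc.prems by (intro Ck_on_add Suc.IH assms) simp_all
  show ?case
    using Ck_on_Suc_has_derivative[OF Suc.prems(1) assms(2)] Ck_on_Suc_has_derivative[OF Suc.prems(2) assms(2)]
    by (intro Ck_on_SucI[OF assms(2) _ IH] bounded_bilinear.FDERIV[OF assms(1)])
qed

lemmas Ck_on_mult = Ck_on_bilinear[OF bounded_bilinear_mult]
  and Ck_on_scaleR = Ck_on_bilinear[OF bounded_bilinear_scaleR]
  and Ck_on_inner = Ck_on_bilinear[OF bounded_bilinear_inner]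

lemma Ck_on_prod:
  fixes f :: "'i \<Rightarrow> 'e::euclidean_space \<Rightarrow> 'f::{real_normed_algebra_1,comm_monoid_mult}"
  assumes "open S" "\<And>i. i \<in> I \<Longrightarrow> Ck_on k S (f i)"
  shows "Ck_on k S (\<lambda>x. \<Prod>i\<in>I. f i x)"
  using assms(2)
proof (induction I rule: infinite_finite_induct)
  case (insert i I)
  show ?case
    unfolding prod.insert[OF insert.hyps] by (intro Ck_on_mult assms(1) insert.IH insert.prems) simp_all
qed (simp_all add: assms(1) del: Ck_on.simps)

lemma Ck_on_compose:
  fixes f :: "'e::euclidean_space \<Rightarrow> 'f::euclidean_space" and g :: "'f \<Rightarrow> 'g::real_normed_vector"
  assumes "open S" "open T" "f ` S \<subseteq> T" "Ck_on k S f" "Ck_on k T g"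
  shows "Ck_on k S (\<lambda>x. g (f x))"
  using assms(4,5)
proof (induction k arbitrary: g)
  case 0
  then show ?case using assms(3) by (auto intro: continuous_on_compose2)
next
  case (Suc k)
  note Df = Ck_on_Suc_has_derivative[OF Suc.prems(1) assms(1)]
  have Dg: "(g has_derivative frechet_derivative g (at (f x))) (at (f x))" if "x \<in> S" for x
    using Ck_on_Suc_has_derivative[OF Suc.prems(2) assms(2)] assms(3) that by blast
  \<comment> \<open>\<open>Ck_on\<close> controls the derivative of \<open>g\<close> in fixed
    directions only, but here the direction moves with \<open>x\<close>; expansion in the basis
    turns this dependence into scalar coefficients.\<close>
  have *: "(\<Sum>b\<in>Basis. (frechet_derivative f (at x) v \<bullet> b) *\<^sub>R frechet_derivative g (at (f x)) b) =
      frechet_derivative g (at (f x)) (frechet_derivative f (at x) v)" if "x \<in> S" for x v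
  proof -
    interpret linear "frechet_derivative g (at (f x))" using Dg[OF that] has_derivative_linear by blast
    show ?thesis by (subst (3) euclidean_representation[symmetric]) (simp add: sum scale)
  qed
  have "Ck_on k S (\<lambda>x. \<Sum>b\<in>Basis. (frechet_derivative f (at x) v \<bullet> b) *\<^sub>R frechet_derivative g (at (f x)) b)" for v
    using Suc.prems assms(1)
    by (intro Ck_on_sum Ck_on_scaleR Ck_on_inner Ck_on_const
        Suc.IH[OF Ck_on_lower[OF Suc.prems(1)], where g = "\<lambda>y. frechet_derivative g (at y) b" for b]) simp_all
  then have "Ck_on k S (\<lambda>x. frechet_derivative g (at (f x)) (frechet_derivative f (at x) v))" for v
    by (rule Ck_on_cong_imp[OF assms(1), rotated]) (simp add: *)
  then show ?case
    using diff_chain_at[OF Df Dg]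
    by (intro Ck_on_SucI[OF assms(1), where f' = "\<lambda>x v. frechet_derivative g (at (f x)) (frechet_derivative f (at x) v)"])
      (auto simp: o_def)
qed

text \<open>The derivative of 1/f is again expressed through 1/f, so the induction hypothesis for
  the same function closes the step; \<open>Ck_on_sqrt\<close> follows the same pattern.\<close>

lemma Ck_on_inverse:
  fixes f :: "'e::euclidean_space \<Rightarrow> real"
  assumes "open S" "\<And>x. x \<in> S \<Longrightarrow> f x \<noteq> 0" "Ck_on k S f"
  shows "Ck_on k S (\<lambda>x. inverse (f x))"
  using assms(3)
proof (induction k)
  case 0
  then show ?case using assms(2) by (auto intro: continuous_on_inverse)
next
  case (Suc k)
  have "Ck_on k S (\<lambda>x. (-1) * (inverse (f x) * frechet_derivative f (at x) v * inverse (f x)))" for v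
    using Suc.IH[OF Ck_on_lower[OF Suc.prems]] Suc.prems assms(1)
    by (intro Ck_on_mult Ck_on_const) simp_all
  moreover have "((\<lambda>x. inverse (f x)) has_derivative
      (\<lambda>v. (-1) * (inverse (f x) * frechet_derivative f (at x) v * inverse (f x)))) (at x)" if "x \<in> S" for x
    using Deriv.has_derivative_inverse[OF assms(2)[OF that] Ck_on_Suc_has_derivative[OF Suc.prems assms(1) that]]
    by simp
  ultimately show ?case
    by (intro Ck_on_SucI[OF assms(1)]) 
qed

lemma Ck_on_sqrt:
  fixes f :: "'e::euclidean_space \<Rightarrow> real"
  assumes "open S" "\<And>x. x \<in> S \<Longrightarrow> f x > 0" "Ck_on k S f"
  shows "Ck_on k S (\<lambda>x. sqrt (f x))"
  using assms(3)
proof (induction k)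
  case 0
  then show ?case by (auto intro: continuous_on_real_sqrt)
next
  case (Suc k)
  have "Ck_on k S (\<lambda>x. (1/2) * (inverse (sqrt (f x)) * frechet_derivative f (at x) v))" for v
    using Suc.IH[OF Ck_on_lower[OF Suc.prems]] Suc.prems assms(1) less_imp_neq[OF assms(2)]
    by (intro Ck_on_mult Ck_on_const Ck_on_inverse) auto
  moreover have "((\<lambda>x. sqrt (f x)) has_derivative
      (\<lambda>v. (1/2) * (inverse (sqrt (f x)) * frechet_derivative f (at x) v))) (at x)" if "x \<in> S" for x
    using has_derivative_real_sqrt[OF assms(2)[OF that] Ck_on_Suc_has_derivative[OF Suc.prems assms(1) that]]
    by (simp add: field_simps)
  ultimately show ?case
    by (intro Ck_on_SucI[OF assms(1)])
qed

lemma Ck_on_vec_nth: "open S \<Longrightarrow> Ck_on k S f \<Longrightarrow> Ck_on k S (\<lambda>x. f x $ i)"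
  by (rule Ck_on_linear_compose[OF bounded_linear_vec_nth])

lemma Ck_on_componentwise:
  fixes f :: "'e::euclidean_space \<Rightarrow> 'f::euclidean_space"
  assumes "open S" "\<And>b. b \<in> Basis \<Longrightarrow> Ck_on k S (\<lambda>x. f x \<bullet> b)"
  shows "Ck_on k S f"
proof -
  have "Ck_on k S (\<lambda>x. \<Sum>b\<in>Basis. (f x \<bullet> b) *\<^sub>R b)"
    using assms by (intro Ck_on_sum Ck_on_scaleR) auto
  then show ?thesis by (simp add: euclidean_representation)
qed

lemma Ck_on_vec:
  fixes f :: "'e::euclidean_space \<Rightarrow> real^'n"
  assumes "open S" "\<And>i. Ck_on k S (\<lambda>x. f x $ i)"
  shows "Ck_on k S f"
  by (rule Ck_on_componentwise) (use assms in \<open>auto simp: Basis_vec_def inner_axis\<close>)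

lemma Ck_on_Pair:
  assumes "open S" "Ck_on k S f" "Ck_on k S g"
  shows "Ck_on k S (\<lambda>x. (f x, g x))"
proof -
  have 1: "bounded_linear (\<lambda>a. (a, 0))" and 2: "bounded_linear (\<lambda>b. (0, b))"
    by (auto intro!: bounded_linear_Pair bounded_linear_ident bounded_linear_zero)
  from Ck_on_add[OF assms(1) Ck_on_linear_compose[OF 1 assms(1,2)] Ck_on_linear_compose[OF 2 assms(1,3)]]
  show ?thesis by simp
qed

section \<open>Linear systems whose coefficients depend on a parameter\<close>

lemma Ck_on_det:
  fixes A :: "'e::euclidean_space \<Rightarrow> real^'n^'n"
  assumes "open S" "\<And>i j. Ck_on k S (\<lambda>x. A x $ i $ j)"
  shows "Ck_on k S (\<lambda>x. det (A x))"
  unfolding det_def by (intro Ck_on_sum Ck_on_mult Ck_on_prod Ck_on_const assms)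

text \<open>By Cramer's rule the solution is a quotient of determinants, which are polynomials in
  the coefficients. This serves both the inverse matrix and the derivative of a lift.\<close>

lemma Ck_on_linear_solve:
  fixes A :: "'e::euclidean_space \<Rightarrow> real^'n^'n"
  assumes "open S" "\<And>i j. Ck_on k S (\<lambda>x. A x $ i $ j)" "\<And>i. Ck_on k S (\<lambda>x. b x $ i)"
    and "\<And>x. x \<in> S \<Longrightarrow> det (A x) \<noteq> 0" "\<And>x. x \<in> S \<Longrightarrow> A x *v w x = b x"
  shows "Ck_on k S w"
proof (rule Ck_on_vec[OF assms(1)])
  fix l
  have "Ck_on k S (\<lambda>x. (\<chi> i j. if j = l then b x $ i else A x $ i $ j) $ i $ j)" for i j
    using assms(2,3) by (cases "j = l") auto
  then have "Ck_on k S (\<lambda>x. det (\<chi> i j. if j = l then b x $ i else A x $ i $ j) * inverse (det (A x)))"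
    using assms by (intro Ck_on_mult Ck_on_det Ck_on_inverse) auto
  moreover have "w x = (\<chi> k. det (\<chi> i j. if j = k then b x $ i else A x $ i $ j) / det (A x))" if "x \<in> S" for x
    using cramer[OF assms(4)[OF that], of "w x" "b x"] assms(5)[OF that] by blast
  ultimately show "Ck_on k S (\<lambda>x. w x $ l)"
    by (elim Ck_on_cong_imp[OF assms(1), rotated]) (simp add: divide_inverse)
qed

lemma matrix_mult_matrix_inv:
  fixes A :: "real^'n^'n"
  assumes "det A \<noteq> 0"
  shows "A ** matrix_inv A = mat 1"
  using assms by (simp add: invertible_det_nz[symmetric] matrix_inv_def invertible_def)
    (metis (mono_tags, lifting) someI_ex)

lemma matrix_mult_column_matrix_inv:
  fixes A :: "real^'n^'n"
  assumes "det A \<noteq> 0"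
  shows "A *v (\<chi> i. matrix_inv A $ i $ j) = axis j 1"
proof -
  have "(A ** matrix_inv A) $ i $ j = (mat 1 :: real^'n^'n) $ i $ j" for i by (simp add: matrix_mult_matrix_inv[OF assms])
  then show ?thesis
    by (simp add: vec_eq_iff matrix_vector_mult_def matrix_matrix_mult_def mat_def axis_def)
qed

lemma Ck_on_matrix_inv:
  fixes A :: "'e::euclidean_space \<Rightarrow> real^'n^'n"
  assumes "open S" "\<And>i j. Ck_on k S (\<lambda>x. A x $ i $ j)" "\<And>x. x \<in> S \<Longrightarrow> det (A x) \<noteq> 0"
  shows "Ck_on k S (\<lambda>x. matrix_inv (A x) $ i $ j)"
proof -
  have "Ck_on k S (\<lambda>x. \<chi> i. matrix_inv (A x) $ i $ j)"
    by (rule Ck_on_linear_solve[where A = A and b = "\<lambda>x. axis j 1"])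
      (use assms in \<open>auto simp: matrix_mult_column_matrix_inv\<close>)
  from Ck_on_vec_nth[OF assms(1) this, of i] show ?thesis by simp
qed

section \<open>Lifting through immersions; symmetry of second derivatives\<close>

text \<open>A continuous lift of a differentiable map through an immersion is differentiable; this
  replaces the inverse function theorem.\<close>

lemma has_derivative_lift:
  fixes P :: "'k::euclidean_space \<Rightarrow> 'f::euclidean_space" and h :: "'m::real_normed_vector \<Rightarrow> 'k"
  assumes P: "(P has_derivative P') (at (h x))" "inj P'" and h: "isCont h x"
    and F: "((\<lambda>x. P (h x)) has_derivative F') (at x)"
  shows "\<exists>h'. (h has_derivative h') (at x)"
proof -
  \<comment> \<open>With a left inverse \<open>L\<close> of \<open>P'\<close>, the map L \<circ> P
    is tangent to the identity at \<open>h x\<close>; to first order \<open>h\<close> is therefore L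
    \<circ> P \<circ> h, whose derivative is known.\<close>
  obtain L where L: "linear L" "L \<circ> P' = id"
    using linear_injective_left_inverse[OF has_derivative_linear[OF P(1)] P(2)] by blast
  have bL: "bounded_linear L" using L(1) linear_conv_bounded_linear by blast
  have q: "((\<lambda>y. L (P y)) has_derivative (\<lambda>v. v)) (at (h x))"
    using bounded_linear.has_derivative[OF bL P(1)] L(2) by (simp add: fun_eq_iff)
  have G: "((\<lambda>x. L (P (h x))) has_derivative (\<lambda>v. L (F' v))) (at x)"
    using bounded_linear.has_derivative[OF bL F] .
  then obtain B where B: "B > 0" "\<And>v. norm (L (F' v)) \<le> norm v * B"
    using bounded_linear.pos_bounded[OF has_derivative_bounded_linear] by blast
  have "(h has_derivative (\<lambda>v. L (F' v))) (at x)"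
    unfolding has_derivative_at_alt
  proof (intro conjI allI impI)
    show "bounded_linear (\<lambda>v. L (F' v))" using G has_derivative_bounded_linear by blast
    fix e :: real assume "e > 0"
    \<comment> \<open>The bound 1/2 lets the error in \<open>norm (h z - h x)\<close> be absorbed,
      which gives a Lipschitz bound with constant 2 (B + 1). The other bound makes this error at
      most half of the allowed one.\<close>
    define \<epsilon> where "\<epsilon> = min (1/2) (e / (4 * (B + 1)))"
    have \<epsilon>: "\<epsilon> > 0" "\<epsilon> \<le> 1/2" "\<epsilon> * (4 * (B + 1)) \<le> e"
    proof -
      have "e / (4 * (B + 1)) * (4 * (B + 1)) = e" using B(1) by simp
      moreover have "\<epsilon> \<le> e / (4 * (B + 1))" by (simp add: \<epsilon>_def)
      ultimately show "\<epsilon> * (4 * (B + 1)) \<le> e"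
        using mult_right_mono[of \<epsilon> "e / (4 * (B + 1))" "4 * (B + 1)"] B(1) by simp
      show "\<epsilon> \<le> 1/2" unfolding \<epsilon>_def by (rule min.cobounded1)
    qed (use \<open>e > 0\<close> B(1) in \<open>auto simp: \<epsilon>_def\<close>)
    define \<eta> where "\<eta> = min 1 (e / 2)"
    have \<eta>: "\<eta> > 0" "\<eta> \<le> 1" "\<eta> \<le> e / 2" using \<open>e > 0\<close> by (auto simp: \<eta>_def)
    obtain d1 where d1: "d1 > 0" "\<And>y. norm (y - h x) < d1 \<Longrightarrow>
        norm (L (P y) - L (P (h x)) - (y - h x)) \<le> \<epsilon> * norm (y - h x)"
      using q \<epsilon>(1) unfolding has_derivative_at_alt by blast
    obtain d2 where d2: "d2 > 0" "\<And>z. norm (z - x) < d2 \<Longrightarrow>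
        norm (L (P (h z)) - L (P (h x)) - L (F' (z - x))) \<le> \<eta> * norm (z - x)"
      using G \<eta>(1) unfolding has_derivative_at_alt by blast
    obtain d3 where d3: "d3 > 0" "\<And>z. norm (z - x) < d3 \<Longrightarrow> norm (h z - h x) < d1"
      using h d1(1) unfolding continuous_at_eps_delta dist_norm by blast
    show "\<exists>d>0. \<forall>z. norm (z - x) < d \<longrightarrow> norm (h z - h x - L (F' (z - x))) \<le> e * norm (z - x)"
    proof (intro exI[of _ "min d2 d3"] conjI allI impI)
      show "min d2 d3 > 0" using d2 d3 by simp
      fix z assume z: "norm (z - x) < min d2 d3"
      define r1 where "r1 = L (P (h z)) - L (P (h x)) - (h z - h x)"
      define r2 where "r2 = L (P (h z)) - L (P (h x)) - L (F' (z - x))"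
      have r1: "norm r1 \<le> \<epsilon> * norm (h z - h x)" using d1(2)[OF d3(2)] z by (simp add: r1_def)
      have r2: "norm r2 \<le> \<eta> * norm (z - x)" using d2(2) z by (simp add: r2_def)
      have "h z - h x = L (F' (z - x)) + r2 - r1" by (simp add: r1_def r2_def)
      then have "norm (h z - h x) \<le> norm (L (F' (z - x))) + norm r2 + norm r1"
        using norm_triangle_ineq4[of "L (F' (z - x)) + r2" r1] norm_triangle_ineq[of "L (F' (z - x))" r2] by simp
      also have "\<dots> \<le> norm (z - x) * B + norm (z - x) + norm (h z - h x) / 2"
        using B(2)[of "z - x"] r1 r2 mult_right_mono[OF \<epsilon>(2) norm_ge_zero[of "h z - h x"]]
          mult_right_mono[OF \<eta>(2) norm_ge_zero[of "z - x"]] by simp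
      finally have "norm (h z - h x) \<le> 2 * (B + 1) * norm (z - x)" by (simp add: algebra_simps)
      then have "norm r1 \<le> \<epsilon> * (2 * (B + 1) * norm (z - x))"
        using r1 \<epsilon>(1) by (meson mult_left_mono less_imp_le order_trans)
      also have "\<dots> = (\<epsilon> * (4 * (B + 1))) * (norm (z - x) / 2)" by simp
      also have "\<dots> \<le> e * (norm (z - x) / 2)" by (rule mult_right_mono[OF \<epsilon>(3)]) simp
      finally have "norm r1 \<le> e * norm (z - x) / 2" by simp
      moreover have "norm r2 \<le> e * norm (z - x) / 2"
        using r2 mult_right_mono[OF \<eta>(3) norm_ge_zero[of "z - x"]] by simp
      moreover have "h z - h x - L (F' (z - x)) = r2 - r1" by (simp add: r1_def r2_def)
      ultimately show "norm (h z - h x - L (F' (z - x))) \<le> e * norm (z - x)"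
        using norm_triangle_ineq4[of r2 r1] by simp
    qed
  qed
  then show ?thesis by blast
qed

lemma smooth_on_has_derivative:
  "smooth_on S f \<Longrightarrow> open S \<Longrightarrow> x \<in> S \<Longrightarrow> (f has_derivative frechet_derivative f (at x)) (at x)"
  unfolding smooth_on_def by (blast intro: Ck_on_Suc_has_derivative)

lemma smooth_on_partial: "smooth_on S f \<Longrightarrow> smooth_on S (partial i f)"
  unfolding smooth_on_def
proof
  fix k assume "\<forall>k. Ck_on k S f"
  then have "Ck_on (Suc k) S f" by blast
  then show "Ck_on k S (partial i f)" by (simp add: partial_def[abs_def])
qed

lemma linear_axis_expansion:
  fixes f :: "real^'n \<Rightarrow> 'f::real_vector"
  assumes "linear f"
  shows "f w = (\<Sum>b\<in>UNIV. w $ b *\<^sub>R f (axis b 1))"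
proof -
  interpret linear f by fact
  show ?thesis by (subst basis_expansion[symmetric]) (simp add: sum scale scalar_mult_eq_scaleR)
qed

text \<open>Bootstrapping: by the chain rule the derivative of \<open>h\<close> solves the normal
  equations DP^T DP Dh = DP^T DF. Matrix and right-hand side are C^k as soon as \<open>h\<close> is,
  and then \<open>h\<close> is C^(k+1).\<close>

lemma smooth_on_lift:
  fixes P :: "real^'k \<Rightarrow> 'f::euclidean_space" and h :: "'e::euclidean_space \<Rightarrow> real^'k"
  assumes "open U" "open S" "h ` S \<subseteq> U" "continuous_on S h" "smooth_on U P"
    and inj: "\<And>y. y \<in> U \<Longrightarrow> inj (frechet_derivative P (at y))"
    and F: "smooth_on S (\<lambda>x. P (h x))"
  shows "smooth_on S h"
proof -
  let ?DP = "\<lambda>y. frechet_derivative P (at y)"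
  note P_Ck = assms(5)[unfolded smooth_on_def, rule_format]
  note F_Ck = F[unfolded smooth_on_def, rule_format]
  have dP: "(P has_derivative ?DP y) (at y)" if "y \<in> U" for y
    using Ck_on_Suc_has_derivative[OF P_Ck assms(1) that] .
  have dh: "(h has_derivative frechet_derivative h (at x)) (at x)" if "x \<in> S" for x
  proof -
    have "h x \<in> U" using that assms(3) by blast
    moreover have "isCont h x" using assms(2,4) that continuous_on_eq_continuous_at by blast
    ultimately show ?thesis
      using has_derivative_lift[OF dP inj _ Ck_on_Suc_has_derivative[OF F_Ck assms(2) that]]
      by (meson differentiableI frechet_derivative_works)
  qed
  have chain: "?DP (h x) (frechet_derivative h (at x) v) = frechet_derivative (\<lambda>x. P (h x)) (at x) v"
    if "x \<in> S" for x v
    using diff_chain_at[OF dh dP, of x] that assms(3) frechet_derivative_at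
    by (fastforce simp: o_def)
  \<comment> \<open>\<open>DP\<close> need not be square, so Cramer's rule is applied to its Gram
    matrix for the Euclidean inner product, which is definite.\<close>
  define M where "M x = (\<chi> a b. ?DP (h x) (axis a 1) \<bullet> ?DP (h x) (axis b 1))" for x
  have M: "M x *v w = (\<chi> a. ?DP (h x) (axis a 1) \<bullet> ?DP (h x) w)" if "x \<in> S" for x w
  proof -
    have "?DP (h x) w = (\<Sum>b\<in>UNIV. w $ b *\<^sub>R ?DP (h x) (axis b 1))"
      using dP that assms(3) by (intro linear_axis_expansion has_derivative_linear) blast
    then show ?thesis
      by (simp add: M_def matrix_vector_mult_def inner_sum_right mult.commute)
  qed
  have det: "det (M x) \<noteq> 0" if "x \<in> S" for x
  proof -
    have "w = 0" if "M x *v w = 0" for w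
    proof -
      interpret linear "?DP (h x)" using dP \<open>x \<in> S\<close> assms(3) has_derivative_linear by blast
      have D0: "?DP (h x) (axis a 1) \<bullet> ?DP (h x) w = 0" for a
        using M[OF \<open>x \<in> S\<close>, of w] that by (simp add: vec_eq_iff)
      have "?DP (h x) w = (\<Sum>b\<in>UNIV. w $ b *\<^sub>R ?DP (h x) (axis b 1))"
        by (intro linear_axis_expansion linear_axioms)
      then have "?DP (h x) w \<bullet> ?DP (h x) w = (\<Sum>b\<in>UNIV. w $ b *\<^sub>R ?DP (h x) (axis b 1)) \<bullet> ?DP (h x) w"
        by simp
      also have "\<dots> = 0" by (simp add: inner_sum_left D0)
      finally have "?DP (h x) w = ?DP (h x) 0" by (simp add: zero)
      moreover have "h x \<in> U" using \<open>x \<in> S\<close> assms(3) by blast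
      ultimately show "w = 0" using injD[OF inj] by blast
    qed
    then show ?thesis
      by (simp add: invertible_det_nz[symmetric] invertible_left_inverse matrix_left_invertible_ker)
  qed
  have "Ck_on k S h" for k
  proof (induction k)
    case 0
    then show ?case using assms(4) by simp
  next
    case (Suc k)
    have DPh: "Ck_on k S (\<lambda>x. ?DP (h x) w)" for w
      using P_Ck[of "Suc k"] Suc.IH
      by (intro Ck_on_compose[OF assms(2,1,3), where g = "\<lambda>y. ?DP y w"]) simp_all
    have DF: "Ck_on k S (\<lambda>x. frechet_derivative (\<lambda>x. P (h x)) (at x) w)" for w
      using F_Ck[of "Suc k"] by simp
    have "Ck_on k S (\<lambda>x. frechet_derivative h (at x) v)" for v
    proof (rule Ck_on_linear_solve[where A = M and
          b = "\<lambda>x. \<chi> a. ?DP (h x) (axis a 1) \<bullet> frechet_derivative (\<lambda>x. P (h x)) (at x) v"])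
      show "M x *v frechet_derivative h (at x) v =
          (\<chi> a. ?DP (h x) (axis a 1) \<bullet> frechet_derivative (\<lambda>x. P (h x)) (at x) v)" if "x \<in> S" for x
        using M[OF that] chain[OF that] by simp
    qed (use assms(2) det DPh DF in \<open>auto simp: M_def intro!: Ck_on_inner\<close>)
    then show ?case
      using dh assms(2) by (intro Ck_on_SucI[where f' = "\<lambda>x. frechet_derivative h (at x)"])
  qed
  then show ?thesis by (simp add: smooth_on_def)
qed

section \<open>Symmetry of second derivatives\<close>

text \<open>The mean value theorem is applied twice: along \<open>v\<close> to the difference of
  \<open>f\<close> at two points that are \<open>h *\<^sub>R w\<close> apart, then along
  \<open>w\<close> to the \<open>v\<close>-derivative.\<close>

lemma second_difference_mean_value:
  fixes f :: "'e::euclidean_space \<Rightarrow> real"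
  assumes f: "Ck_on 2 (ball x r) f" and h: "h > 0" "h * (norm v + norm w) < r"
  obtains s t where "0 < s" "s < h" "0 < t" "t < h"
    "f (x + h *\<^sub>R v + h *\<^sub>R w) - f (x + h *\<^sub>R v) - f (x + h *\<^sub>R w) + f x =
     h * (h * frechet_derivative (\<lambda>y. frechet_derivative f (at y) v) (at (x + s *\<^sub>R v + t *\<^sub>R w)) w)"
proof -
  let ?D = "\<lambda>y. frechet_derivative f (at y)"
  have in_ball: "x + s *\<^sub>R v + t *\<^sub>R w \<in> ball x r" if "0 \<le> s" "s \<le> h" "0 \<le> t" "t \<le> h" for s t
  proof -
    have "norm (s *\<^sub>R v + t *\<^sub>R w) \<le> s * norm v + t * norm w"
      using norm_triangle_ineq[of "s *\<^sub>R v" "t *\<^sub>R w"] that by simp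
    also have "\<dots> \<le> h * norm v + h * norm w" using that by (intro add_mono mult_right_mono) auto
    finally have "norm (s *\<^sub>R v + t *\<^sub>R w) < r" using h(2) by (simp add: distrib_left)
    moreover have "dist x (x + s *\<^sub>R v + t *\<^sub>R w) = norm (s *\<^sub>R v + t *\<^sub>R w)"
      by (metis add.assoc dist_add_cancel dist_0_norm add.right_neutral)
    ultimately show ?thesis by simp
  qed
  have f1: "Ck_on (Suc 1) (ball x r) f" using f by (simp add: numeral_2_eq_2)
  have D: "(f has_derivative ?D y) (at y)" if "y \<in> ball x r" for y
    using Ck_on_Suc_has_derivative[OF f1 open_ball that] .
  have D2: "((\<lambda>y. ?D y v) has_derivative frechet_derivative (\<lambda>y. ?D y v) (at y)) (at y)" if "y \<in> ball x r" for y
    using Ck_on_Suc_has_derivative[OF _ open_ball that] f1 by (metis Ck_on.simps(2) One_nat_def)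
  have d1: "((\<lambda>s. f (x + s *\<^sub>R v + t *\<^sub>R w)) has_real_derivative ?D (x + s *\<^sub>R v + t *\<^sub>R w) v) (at s)"
    if "0 \<le> s" "s \<le> h" "0 \<le> t" "t \<le> h" for s t
  proof -
    have "((\<lambda>s. x + s *\<^sub>R v + t *\<^sub>R w) has_derivative (\<lambda>u. u *\<^sub>R v)) (at s)"
      by (auto intro!: derivative_eq_intros)
    from has_derivative_compose[OF this D[OF in_ball[OF that]]] show ?thesis
      by (rule has_derivative_imp_has_field_derivative)
        (simp add: linear_cmul[OF has_derivative_linear[OF D[OF in_ball[OF that]]]])
  qed
  have d2: "((\<lambda>t. ?D (x + s *\<^sub>R v + t *\<^sub>R w) v) has_real_derivative
      frechet_derivative (\<lambda>y. ?D y v) (at (x + s *\<^sub>R v + t *\<^sub>R w)) w) (at t)"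
    if "0 \<le> s" "s \<le> h" "0 \<le> t" "t \<le> h" for s t
  proof -
    have "((\<lambda>t. x + s *\<^sub>R v + t *\<^sub>R w) has_derivative (\<lambda>u. u *\<^sub>R w)) (at t)"
      by (auto intro!: derivative_eq_intros)
    from has_derivative_compose[OF this D2[OF in_ball[OF that]]] show ?thesis
      by (rule has_derivative_imp_has_field_derivative)
        (simp add: linear_cmul[OF has_derivative_linear[OF D2[OF in_ball[OF that]]]])
  qed
  define \<phi> where "\<phi> s = f (x + s *\<^sub>R v + h *\<^sub>R w) - f (x + s *\<^sub>R v + 0 *\<^sub>R w)" for s
  have "\<exists>s>0. s < h \<and> \<phi> h - \<phi> 0 = (h - 0) * (?D (x + s *\<^sub>R v + h *\<^sub>R w) v - ?D (x + s *\<^sub>R v + 0 *\<^sub>R w) v)"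
    unfolding \<phi>_def using h(1) by (intro MVT2 DERIV_diff d1) auto
  then obtain s where s: "0 < s" "s < h"
    "\<phi> h - \<phi> 0 = h * (?D (x + s *\<^sub>R v + h *\<^sub>R w) v - ?D (x + s *\<^sub>R v + 0 *\<^sub>R w) v)" by auto
  have "\<exists>t>0. t < h \<and> ?D (x + s *\<^sub>R v + h *\<^sub>R w) v - ?D (x + s *\<^sub>R v + 0 *\<^sub>R w) v
      = (h - 0) * frechet_derivative (\<lambda>y. ?D y v) (at (x + s *\<^sub>R v + t *\<^sub>R w)) w"
    using h(1) s(1,2) by (intro MVT2[where f = "\<lambda>t. ?D (x + s *\<^sub>R v + t *\<^sub>R w) v"] d2) auto
  then obtain t where "0 < t" "t < h" "?D (x + s *\<^sub>R v + h *\<^sub>R w) v - ?D (x + s *\<^sub>R v + 0 *\<^sub>R w) v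
      = h * frechet_derivative (\<lambda>y. ?D y v) (at (x + s *\<^sub>R v + t *\<^sub>R w)) w" by auto
  with s show ?thesis by (intro that[of s t]) (simp_all add: \<phi>_def)
qed

text \<open>The second difference is unchanged when \<open>v\<close> and \<open>w\<close> are
  exchanged, so the two mixed derivatives share a value at two points close to \<open>x\<close>,
  possibly different ones; continuity at \<open>x\<close> then excludes a gap.\<close>

lemma second_derivative_symmetric_real:
  fixes f :: "'e::euclidean_space \<Rightarrow> real"
  assumes "open S" "x \<in> S" and f: "Ck_on 2 S f"
  shows "frechet_derivative (\<lambda>y. frechet_derivative f (at y) v) (at x) w =
         frechet_derivative (\<lambda>y. frechet_derivative f (at y) w) (at x) v"
proof (rule ccontr)
  define A where "A y = frechet_derivative (\<lambda>y. frechet_derivative f (at y) v) (at y) w" for y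
  define B where "B y = frechet_derivative (\<lambda>y. frechet_derivative f (at y) w) (at y) v" for y
  assume "\<not> ?thesis"
  then have e: "\<bar>A x - B x\<bar> > 0" by (simp add: A_def B_def)
  have "continuous_on S A" "continuous_on S B"
    using f by (auto simp: A_def B_def numeral_2_eq_2)
  then have "isCont A x" "isCont B x" using assms(1,2) continuous_on_eq_continuous_at by blast+
  then have "\<forall>\<^sub>F y in nhds x. dist (A y) (A x) < \<bar>A x - B x\<bar> / 2 \<and> dist (B y) (B x) < \<bar>A x - B x\<bar> / 2"
    using e by (intro eventually_conj tendstoD) (auto simp: continuous_at tendsto_nhds_iff isCont_def)
  then obtain d where d: "d > 0" "\<And>y. dist y x < d \<Longrightarrow>
      dist (A y) (A x) < \<bar>A x - B x\<bar> / 2 \<and> dist (B y) (B x) < \<bar>A x - B x\<bar> / 2"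
    unfolding eventually_nhds_metric by blast
  obtain r where r: "r > 0" "ball x r \<subseteq> S" using assms(1,2) openE by blast
  define m where "m = min r d"
  have m: "m > 0" using r d by (simp add: m_def)
  have "Ck_on 2 (ball x m) f" using f r by (rule_tac Ck_on_subset) (auto simp: m_def)
  \<comment> \<open>This step size makes h (norm v + norm w) smaller than \<open>m\<close>, which
    keeps the second difference inside the ball and the mean value points within \<open>d\<close> of
    \<open>x\<close>.\<close>
  define h where "h = m / (2 * (norm v + norm w + 1))"
  have nn: "0 < norm v + norm w + 1" by (smt (verit) norm_ge_zero)
  have h: "h > 0" using m nn by (simp add: h_def)
  have hm: "h * (norm v + norm w) < m"
  proof -
    have "h * (norm v + norm w) < h * (2 * (norm v + norm w + 1))"
      using h by (intro mult_strict_left_mono) (smt (verit) norm_ge_zero)+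
    then show ?thesis using nn by (simp add: h_def)
  qed
  have near: "dist (x + s *\<^sub>R a + t *\<^sub>R b) x < d"
    if "0 < s" "s < h" "0 < t" "t < h" "h * (norm a + norm b) < m" for s t a b
  proof -
    have "norm (s *\<^sub>R a + t *\<^sub>R b) \<le> s * norm a + t * norm b"
      using norm_triangle_ineq[of "s *\<^sub>R a" "t *\<^sub>R b"] that by simp
    also have "\<dots> \<le> h * norm a + h * norm b" using that by (intro add_mono mult_right_mono) auto
    also have "\<dots> < d" using that(5) by (simp add: m_def algebra_simps)
    finally show ?thesis by (simp add: dist_norm algebra_simps)
  qed
  obtain s t where st: "0 < s" "s < h" "0 < t" "t < h"
    "f (x + h *\<^sub>R v + h *\<^sub>R w) - f (x + h *\<^sub>R v) - f (x + h *\<^sub>R w) + f x = h * (h * A (x + s *\<^sub>R v + t *\<^sub>R w))"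
    using second_difference_mean_value[OF \<open>Ck_on 2 (ball x m) f\<close> h hm] unfolding A_def by metis
  have hm': "h * (norm w + norm v) < m" using hm by (simp add: add.commute)
  obtain s' t' where st': "0 < s'" "s' < h" "0 < t'" "t' < h"
    "f (x + h *\<^sub>R w + h *\<^sub>R v) - f (x + h *\<^sub>R w) - f (x + h *\<^sub>R v) + f x = h * (h * B (x + s' *\<^sub>R w + t' *\<^sub>R v))"
    using second_difference_mean_value[OF \<open>Ck_on 2 (ball x m) f\<close> h hm'] unfolding B_def by metis
  have "x + h *\<^sub>R w + h *\<^sub>R v = x + h *\<^sub>R v + h *\<^sub>R w" by simp
  with st(5) st'(5) have "h * (h * A (x + s *\<^sub>R v + t *\<^sub>R w)) = h * (h * B (x + s' *\<^sub>R w + t' *\<^sub>R v))"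
    by (smt (verit))
  then have "A (x + s *\<^sub>R v + t *\<^sub>R w) = B (x + s' *\<^sub>R w + t' *\<^sub>R v)" using h by simp
  with d(2)[OF near[OF st(1-4) hm]] d(2)[OF near[OF st'(1-4) hm']] show False
    by (simp add: dist_real_def abs_if split: if_splits)
qed

lemma frechet_derivative_inner:
  assumes "f differentiable at x"
  shows "frechet_derivative (\<lambda>y. f y \<bullet> b) (at x) v = frechet_derivative f (at x) v \<bullet> b"
  by (rule fun_cong[OF frechet_derivative_at[OF has_derivative_inner_left[OF assms[unfolded frechet_derivative_works]]], symmetric])

lemma second_derivative_symmetric:
  fixes f :: "'e::euclidean_space \<Rightarrow> 'f::euclidean_space"
  assumes "open S" "x \<in> S" and f: "Ck_on 2 S f"
  shows "frechet_derivative (\<lambda>y. frechet_derivative f (at y) v) (at x) w =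
         frechet_derivative (\<lambda>y. frechet_derivative f (at y) w) (at x) v"
proof (rule euclidean_eqI)
  fix b :: 'f assume "b \<in> Basis"
  have f1: "Ck_on (Suc 1) S f" using f by (simp add: numeral_2_eq_2)
  have D: "f differentiable at y" if "y \<in> S" for y
    using Ck_on_Suc_has_derivative[OF f1 assms(1) that] differentiableI by blast
  have *: "frechet_derivative (\<lambda>y. frechet_derivative (\<lambda>z. f z \<bullet> b) (at y) v) (at x) w =
      frechet_derivative (\<lambda>y. frechet_derivative f (at y) v) (at x) w \<bullet> b" for v w
  proof -
    have D2: "(\<lambda>y. frechet_derivative f (at y) v) differentiable at x"
      using f1 assms(1,2) by (simp add: differentiable_on_eq_differentiable_at)
    then have "(\<lambda>y. frechet_derivative f (at y) v \<bullet> b) differentiable at x" by simp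
    then have "frechet_derivative (\<lambda>y. frechet_derivative f (at y) v \<bullet> b) (at x) =
       frechet_derivative (\<lambda>y. frechet_derivative (\<lambda>z. f z \<bullet> b) (at y) v) (at x)"
      by (rule frechet_derivative_transform_within_open[OF _ assms(1,2)])
        (simp add: frechet_derivative_inner[OF D])
    then show ?thesis using frechet_derivative_inner[OF D2] by metis
  qed
  have "Ck_on 2 S (\<lambda>z. f z \<bullet> b)" using f assms(1) by (intro Ck_on_inner Ck_on_const)
  from second_derivative_symmetric_real[OF assms(1,2) this, of v w]
  show "frechet_derivative (\<lambda>y. frechet_derivative f (at y) v) (at x) w \<bullet> b =
      frechet_derivative (\<lambda>y. frechet_derivative f (at y) w) (at x) v \<bullet> b" by (simp add: *)
qed

section \<open>Mean curvature in terms of the ambient Minkowski space\<close>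

text \<open>Negating the time component of the first argument reduces the product to the Euclidean
  one; this makes the product rule available for it.\<close>

lemma bounded_bilinear_lorentz: "bounded_bilinear (lorentz :: real \<times> (real^'d) \<Rightarrow> _)"
proof -
  have "bounded_linear (\<lambda>v :: real \<times> (real^'d). (- fst v, snd v))"
    by (intro bounded_linear_Pair bounded_linear_minus bounded_linear_fst bounded_linear_snd)
  from bounded_bilinear.comp1[OF bounded_bilinear_inner this]
  moreover have "lorentz = (\<lambda>v :: real \<times> (real^'d). (\<bullet>) (- fst v, snd v))"
    by (simp add: fun_eq_iff lorentz_def inner_prod_def)
  ultimately show ?thesis by simp
qed

interpretation lorentz: bounded_bilinear lorentz
  by (rule bounded_bilinear_lorentz)

lemma lorentz_commute: "lorentz v w = lorentz w v"
  by (simp add: lorentz_def inner_commute mult.commute)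

definition first_form :: "(real^'m \<Rightarrow> real \<times> (real^'d)) \<Rightarrow> real^'m \<Rightarrow> real^'m^'m::finite" where
  "first_form F x = (\<chi> i j. lorentz (partial i F x) (partial j F x))"

definition trace_hessian :: "(real^'m \<Rightarrow> real \<times> (real^'d)) \<Rightarrow> real^'m::finite \<Rightarrow> real \<times> (real^'d)" where
  "trace_hessian F x = (\<Sum>i\<in>UNIV. \<Sum>j\<in>UNIV. matrix_inv (first_form F x) $ i $ j *\<^sub>R partial i (partial j F) x)"

text \<open>For a spacelike \<open>F\<close> this is \<open>CARD('m)\<close> times its mean
  curvature vector in flat Minkowski space. Christoffel symbols of the induced metric do not occur,
  since they would only add tangential vectors. No ambient manifold occurs either, so Q(1) and the
  slices share this vector.\<close>

definition normal_trace_hessian :: "(real^'m \<Rightarrow> real \<times> (real^'d)) \<Rightarrow> real^'m::finite \<Rightarrow> real \<times> (real^'d)" where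
  "normal_trace_hessian F x = trace_hessian F x - (\<Sum>k\<in>UNIV. \<Sum>l\<in>UNIV.
     (matrix_inv (first_form F x) $ k $ l * lorentz (trace_hessian F x) (partial l F x)) *\<^sub>R partial k F x)"

text \<open>In use \<open>P\<close> is the inverse of an ambient chart, \<open>u\<close> the map in
  coordinates and \<open>P (u x)\<close> the map into Minkowski space.\<close>

locale local_lift =
  fixes P :: "real^'k \<Rightarrow> real \<times> (real^'d)" and u :: "real^'m \<Rightarrow> real^'k" and U W
  assumes U: "open U" and W: "open W" and u_in: "x \<in> W \<Longrightarrow> u x \<in> U"
    and smooth_P: "smooth_on U P" and smooth_u: "smooth_on W u"
begin

abbreviation "DP y \<equiv> frechet_derivative P (at y)"
abbreviation "F \<equiv> \<lambda>x. P (u x)"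

lemmas P_deriv = smooth_on_has_derivative[OF smooth_P U]
  and P2_deriv = smooth_on_has_derivative[OF smooth_on_partial[OF smooth_P] U]
  and u_deriv = smooth_on_has_derivative[OF smooth_u W]
  and u2_deriv = smooth_on_has_derivative[OF smooth_on_partial[OF smooth_u] W]

lemma DP_expand: "y \<in> U \<Longrightarrow> DP y w = (\<Sum>b\<in>UNIV. w $ b *\<^sub>R partial b P y)"
  unfolding partial_def using P_deriv by (intro linear_axis_expansion has_derivative_linear)

lemma D2P_expand:
  "y \<in> U \<Longrightarrow> frechet_derivative (partial b P) (at y) w = (\<Sum>a\<in>UNIV. w $ a *\<^sub>R partial a (partial b P) y)"
  unfolding partial_def[of _ "partial b P"]
  using P2_deriv by (intro linear_axis_expansion has_derivative_linear)

lemma F_has_derivative: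
  assumes "x \<in> W"
  shows "(F has_derivative (\<lambda>v. DP (u x) (frechet_derivative u (at x) v))) (at x)"
  using diff_chain_at[OF u_deriv[OF assms] P_deriv[OF u_in[OF assms]]] by (simp add: o_def)

lemma F_frechet: "x \<in> W \<Longrightarrow> frechet_derivative F (at x) v = DP (u x) (frechet_derivative u (at x) v)"
  using fun_cong[OF frechet_derivative_at[OF F_has_derivative]] by metis

lemma partial_F: "x \<in> W \<Longrightarrow> partial i F x = DP (u x) (partial i u x)"
  by (simp add: partial_def F_frechet)

text \<open>The first-order chain rule holds on the whole open set \<open>W\<close>, so it may be
  differentiated once more. The quadratic term is what the Christoffel symbols have to
  reproduce.\<close>

lemma partial_partial_F:
  assumes "x \<in> W"
  shows "partial i (partial j F) x = DP (u x) (partial i (partial j u) x) +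
    (\<Sum>a\<in>UNIV. \<Sum>b\<in>UNIV. (partial i u x $ a * partial j u x $ b) *\<^sub>R partial a (partial b P) (u x))"
proof -
  have eq: "(\<Sum>b\<in>UNIV. partial j u z $ b *\<^sub>R partial b P (u z)) = partial j F z" if "z \<in> W" for z
    using DP_expand[OF u_in[OF that]] by (simp add: partial_F[OF that])
  have d: "((\<lambda>z. \<Sum>b\<in>UNIV. partial j u z $ b *\<^sub>R partial b P (u z)) has_derivative
      (\<lambda>v. \<Sum>b\<in>UNIV. partial j u x $ b *\<^sub>R frechet_derivative (partial b P) (at (u x)) (frechet_derivative u (at x) v)
        + (frechet_derivative (partial j u) (at x) v $ b) *\<^sub>R partial b P (u x))) (at x)"
    using diff_chain_at[OF u_deriv[OF assms] P2_deriv[OF u_in[OF assms]]] u2_deriv[OF assms]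
    by (intro has_derivative_sum has_derivative_scaleR bounded_linear.has_derivative[OF bounded_linear_vec_nth])
      (simp_all add: o_def)
  have "partial i (partial j F) x = (\<Sum>b\<in>UNIV. partial j u x $ b *\<^sub>R
        frechet_derivative (partial b P) (at (u x)) (frechet_derivative u (at x) (axis i 1))
        + (frechet_derivative (partial j u) (at x) (axis i 1) $ b) *\<^sub>R partial b P (u x))"
    unfolding partial_def[of i "partial j F"]
    by (rule fun_cong[OF frechet_derivative_at, symmetric])
      (rule has_derivative_transform_within_open[OF d W assms eq])
  also have "\<dots> = (\<Sum>b\<in>UNIV. \<Sum>a\<in>UNIV. (partial i u x $ a * partial j u x $ b) *\<^sub>R partial a (partial b P) (u x))
      + DP (u x) (partial i (partial j u) x)"
    by (simp add: sum.distrib D2P_expand[OF u_in[OF assms]] DP_expand[OF u_in[OF assms]] partial_def[symmetric]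
        scaleR_sum_right mult.commute)
  also have "(\<Sum>b\<in>UNIV. \<Sum>a\<in>UNIV. (partial i u x $ a * partial j u x $ b) *\<^sub>R partial a (partial b P) (u x)) =
      (\<Sum>a\<in>UNIV. \<Sum>b\<in>UNIV. (partial i u x $ a * partial j u x $ b) *\<^sub>R partial a (partial b P) (u x))"
    by (rule sum.swap)
  finally show ?thesis by (simp only: add.commute)
qed

lemma partial_commute:
  assumes "y \<in> U"
  shows "partial a (partial b P) y = partial b (partial a P) y"
  using second_derivative_symmetric[OF U assms, of P "axis b 1" "axis a 1"] smooth_P
  by (simp add: partial_def[abs_def] smooth_on_def)

lemma partial_metric:
  assumes "y \<in> U"
  shows "partial a (\<lambda>z. lorentz (partial b P z) (partial h P z)) y =
    lorentz (partial b P y) (partial a (partial h P) y) + lorentz (partial a (partial b P) y) (partial h P y)"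
  unfolding partial_def[of a]
  by (rule fun_cong[OF frechet_derivative_at, symmetric])
    (intro lorentz.FDERIV P2_deriv assms)

context
  fixes N :: "('b, 'k, 'z) semi_riemannian_scheme" and d :: "('b, 'k) chart"
  assumes metric: "metric N d = (\<lambda>y v w. lorentz (DP y v) (DP y w))"
begin

lemma gram_metric: "gram (metric N d z) = (\<chi> a b. lorentz (partial a P z) (partial b P z))"
  by (simp add: gram_def metric partial_def)

text \<open>As the metric comes from flat space, the product rule turns its three derivatives into
  six terms; by symmetry of second derivatives four of them cancel and two equal ones
  remain.\<close>

lemma christoffel_eq:
  assumes "y \<in> U"
  shows "christoffel N d y e a b =
    (\<Sum>h\<in>UNIV. matrix_inv (gram (metric N d y)) $ e $ h * lorentz (partial a (partial b P) y) (partial h P y))"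
proof -
  have "partial a (\<lambda>z. gram (metric N d z) $ b $ h) y + partial b (\<lambda>z. gram (metric N d z) $ a $ h) y
      - partial h (\<lambda>z. gram (metric N d z) $ a $ b) y = 2 * lorentz (partial a (partial b P) y) (partial h P y)" for h
    using partial_commute[OF assms, of a b] partial_commute[OF assms, of a h] partial_commute[OF assms, of b h]
    by (simp add: gram_metric partial_metric[OF assms] lorentz_commute[of "partial b P y"])
  then show ?thesis by (simp add: christoffel_def Let_def sum_distrib_left)
qed

lemma metric_vec:
  assumes "y \<in> U"
  shows "metric N d y v w = w \<bullet> (gram (metric N d y) *v v)"
proof -
  have "metric N d y v w = (\<Sum>b\<in>UNIV. \<Sum>a\<in>UNIV. v $ a * w $ b * lorentz (partial a P y) (partial b P y))"
    by (simp add: metric DP_expand[OF assms] lorentz.sum_left lorentz.sum_right lorentz.scaleR_left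
        lorentz.scaleR_right mult_ac sum_distrib_left)
  also have "\<dots> = w \<bullet> (gram (metric N d y) *v v)"
    by (simp add: inner_vec_def matrix_vector_mult_def gram_metric sum_distrib_left mult_ac
        lorentz_commute[of "partial _ P y" "partial _ P y"])
  finally show ?thesis .
qed

lemma metric_linear:
  assumes "y \<in> U"
  shows "linear (\<lambda>v. metric N d y v w)"
  unfolding metric
  using has_derivative_bounded_linear[OF P_deriv[OF assms]] lorentz.bounded_linear_left
  by (intro bounded_linear.linear) (rule bounded_linear_compose)

text \<open>Pairing lowers the index: the Gram matrix meets its own inverse, and the Christoffel
  symbols become second derivatives of \<open>P\<close> tested against tangent vectors.\<close>

lemma metric_cov_deriv_christoffel:
  assumes y: "y \<in> U" and nondeg: "\<And>v. (\<And>w. metric N d y v w = 0) \<Longrightarrow> v = 0"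
  shows "metric N d y (\<chi> e. \<Sum>a\<in>UNIV. \<Sum>b\<in>UNIV. christoffel N d y e a b * p $ a * q $ b) w =
    lorentz (\<Sum>a\<in>UNIV. \<Sum>b\<in>UNIV. (p $ a * q $ b) *\<^sub>R partial a (partial b P) y) (DP y w)"
    (is "metric N d y ?\<Gamma> w = lorentz ?Q _")
proof -
  define G where "G = gram (metric N d y)"
  define r where "r = (\<chi> h. lorentz ?Q (partial h P y))"
  \<comment> \<open>Nondegeneracy of the metric makes \<open>matrix_inv G\<close> a genuine
    inverse.\<close>
  have "v = 0" if "G *v v = 0" for v
    using nondeg[of v] metric_vec[OF y, of v] that by (simp add: G_def)
  then have "det G \<noteq> 0"
    by (simp add: invertible_det_nz[symmetric] invertible_left_inverse matrix_left_invertible_ker)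
  note inv = matrix_mult_matrix_inv[OF this]
  have "?\<Gamma> = matrix_inv G *v r"
  proof (rule vec_eq_iff[THEN iffD2, rule_format])
    fix e
    have "?\<Gamma> $ e = (\<Sum>a\<in>UNIV. \<Sum>b\<in>UNIV. \<Sum>h\<in>UNIV.
        matrix_inv G $ e $ h * (p $ a * q $ b * lorentz (partial a (partial b P) y) (partial h P y)))"
      by (simp add: christoffel_eq[OF y] G_def sum_distrib_left sum_distrib_right mult_ac)
    also have "\<dots> = (\<Sum>a\<in>UNIV. \<Sum>h\<in>UNIV. \<Sum>b\<in>UNIV.
        matrix_inv G $ e $ h * (p $ a * q $ b * lorentz (partial a (partial b P) y) (partial h P y)))"
      by (intro sum.cong refl sum.swap)
    also have "\<dots> = (\<Sum>h\<in>UNIV. \<Sum>a\<in>UNIV. \<Sum>b\<in>UNIV.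
        matrix_inv G $ e $ h * (p $ a * q $ b * lorentz (partial a (partial b P) y) (partial h P y)))"
      by (rule sum.swap)
    also have "\<dots> = (matrix_inv G *v r) $ e"
      by (simp add: matrix_vector_mult_def r_def lorentz.sum_left lorentz.scaleR_left sum_distrib_left)
    finally show "?\<Gamma> $ e = (matrix_inv G *v r) $ e" .
  qed
  then have "metric N d y ?\<Gamma> w = w \<bullet> r"
    using metric_vec[OF y, of ?\<Gamma> w] inv by (simp add: G_def[symmetric] matrix_vector_mul_assoc)
  also have "\<dots> = lorentz ?Q (DP y w)"
    by (simp add: DP_expand[OF y, of w] inner_vec_def r_def lorentz.sum_right lorentz.scaleR_right)
  finally show ?thesis .
qed

context
  fixes \<psi> :: "'a \<Rightarrow> 'b" and c :: "('a, 'm) chart" and x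
  assumes loc_rep: "loc_rep \<psi> c d = u" and x: "x \<in> W"
    and nondeg: "\<And>v. (\<And>w. metric N d (u x) v w = 0) \<Longrightarrow> v = 0"
begin

text \<open>The covariant derivative is the tangential projection of the second derivative in
  Minkowski space.\<close>

lemma metric_cov_deriv:
  "metric N d (u x) (cov_deriv N \<psi> c d x i j) w = lorentz (partial i (partial j F) x) (DP (u x) w)"
proof -
  have "cov_deriv N \<psi> c d x i j = partial i (partial j u) x +
     (\<chi> e. \<Sum>a\<in>UNIV. \<Sum>b\<in>UNIV. christoffel N d (u x) e a b * partial i u x $ a * partial j u x $ b)"
    by (simp add: cov_deriv_def loc_rep Let_def vec_eq_iff)
  then have "metric N d (u x) (cov_deriv N \<psi> c d x i j) w = metric N d (u x) (partial i (partial j u) x) w +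
     metric N d (u x) (\<chi> e. \<Sum>a\<in>UNIV. \<Sum>b\<in>UNIV. christoffel N d (u x) e a b * partial i u x $ a * partial j u x $ b) w"
    using linear_add[OF metric_linear[OF u_in[OF x]]] by simp
  also have "\<dots> = lorentz (partial i (partial j F) x) (DP (u x) w)"
    by (subst metric_cov_deriv_christoffel[OF u_in[OF x] nondeg])
      (simp_all add: partial_partial_F[OF x] metric lorentz.add_left)
  finally show ?thesis .
qed

lemma induced_metric_eq:
  "induced_metric N \<psi> c d x v w = lorentz (frechet_derivative F (at x) v) (frechet_derivative F (at x) w)"
  by (simp add: induced_metric_def loc_rep Let_def metric F_frechet[OF x])

lemma gram_induced_metric: "gram (induced_metric N \<psi> c d x) = first_form F x"
  by (simp add: gram_def induced_metric_eq first_form_def partial_def)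

text \<open>Removing the tangential part is linear, so it commutes with the trace over
  \<open>i\<close> and \<open>j\<close>. Pairings are used because the mean curvature is given in
  chart components, whereas the trace of the Hessian lies in Minkowski space and need not be tangent
  to the ambient submanifold.\<close>

lemma metric_mean_curvature:
  "metric N d (u x) (mean_curvature N \<psi> c d x) w =
     1 / real CARD('m) * lorentz (normal_trace_hessian F x) (DP (u x) w)"
proof -
  define gi where "gi = matrix_inv (first_form F x)"
  define B where "B v = metric N d (u x) v w" for v
  define nrm where "nrm z = z - (\<Sum>k\<in>UNIV. \<Sum>l\<in>UNIV. (gi $ k $ l * lorentz z (partial l F x)) *\<^sub>R partial k F x)" for z
  define \<phi> where "\<phi> z = lorentz (nrm z) (DP (u x) w)" for z
  have lin_B: "linear B" unfolding B_def by (rule metric_linear[OF u_in[OF x]])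
  have "linear nrm" unfolding nrm_def
    by (rule linearI) (simp_all add: lorentz.add_left lorentz.scaleR_left algebra_simps sum.distrib scaleR_sum_right)
  then have lin_\<phi>: "linear \<phi>" unfolding \<phi>_def
    using linear_compose[OF _ bounded_linear.linear[OF lorentz.bounded_linear_left]] by (simp add: o_def)
  have II: "B (second_fundamental_form N \<psi> c d x i j) = \<phi> (partial i (partial j F) x)" for i j
  proof -
    let ?C = "cov_deriv N \<psi> c d x i j"
    have mu: "metric N d (u x) ?C (partial l u x) = lorentz (partial i (partial j F) x) (partial l F x)" for l
      by (simp add: metric_cov_deriv partial_F[OF x])
    have Bu: "B (partial k u x) = lorentz (partial k F x) (DP (u x) w)" for k
      by (simp add: B_def metric partial_F[OF x])
    have BC: "B ?C = lorentz (partial i (partial j F) x) (DP (u x) w)"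
      by (simp add: B_def metric_cov_deriv)
    show ?thesis
      by (simp add: second_fundamental_form_def normal_part_def Let_def loc_rep gram_induced_metric mu
          gi_def[symmetric] linear_diff[OF lin_B] linear_sum[OF lin_B] linear_scale[OF lin_B] Bu BC \<phi>_def nrm_def
          lorentz.diff_left lorentz.sum_left lorentz.scaleR_left)
  qed
  have "metric N d (u x) (mean_curvature N \<psi> c d x) w = B (mean_curvature N \<psi> c d x)" by (simp add: B_def)
  also have "\<dots> = 1 / real CARD('m) * (\<Sum>i\<in>UNIV. \<Sum>j\<in>UNIV. gi $ i $ j * \<phi> (partial i (partial j F) x))"
    by (simp add: mean_curvature_def Let_def gram_induced_metric gi_def[symmetric] II
        linear_sum[OF lin_B] linear_scale[OF lin_B])
  also have "(\<Sum>i\<in>UNIV. \<Sum>j\<in>UNIV. gi $ i $ j * \<phi> (partial i (partial j F) x)) = \<phi> (trace_hessian F x)"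
    by (simp add: trace_hessian_def gi_def[symmetric] linear_sum[OF lin_\<phi>] linear_scale[OF lin_\<phi>])
  also have "\<dots> = lorentz (normal_trace_hessian F x) (DP (u x) w)"
    by (simp add: \<phi>_def nrm_def normal_trace_hessian_def gi_def)
  finally show ?thesis .
qed

lemma mean_curvature_eq_0_iff:
  "mean_curvature N \<psi> c d x = 0 \<longleftrightarrow> (\<forall>w. lorentz (normal_trace_hessian F x) (DP (u x) w) = 0)"
proof
  assume "mean_curvature N \<psi> c d x = 0"
  then have "metric N d (u x) (mean_curvature N \<psi> c d x) w = 0" for w
    using linear_0[OF metric_linear[OF u_in[OF x]]] by simp
  then show "\<forall>w. lorentz (normal_trace_hessian F x) (DP (u x) w) = 0"
    by (simp add: metric_mean_curvature)
qed (simp add: nondeg metric_mean_curvature)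

end

end

end

section \<open>Locality of derivatives, and charts of submanifolds of Minkowski space\<close>

text \<open>No differentiability enters: both functions have the same candidate derivatives, so the
  choice operator picks the same one.\<close>

lemma frechet_derivative_cong:
  assumes "open W" "x \<in> W" "\<And>z. z \<in> W \<Longrightarrow> f z = g z"
  shows "frechet_derivative f (at x) = frechet_derivative g (at x)"
proof -
  have "(f has_derivative f') (at x) \<longleftrightarrow> (g has_derivative f') (at x)" for f'
    using has_derivative_transform_within_open[OF _ assms(1,2)] assms(3) by metis
  then show ?thesis by (simp add: frechet_derivative_def)
qed

lemma partial_cong:
  "open W \<Longrightarrow> x \<in> W \<Longrightarrow> (\<And>z. z \<in> W \<Longrightarrow> f z = g z) \<Longrightarrow> partial i f x = partial i g x"
  unfolding partial_def by (metis frechet_derivative_cong)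

lemma normal_trace_hessian_cong:
  assumes "open W" "x \<in> W" "\<And>z. z \<in> W \<Longrightarrow> F z = G z"
  shows "normal_trace_hessian F x = normal_trace_hessian G x"
proof -
  have 1: "partial i F z = partial i G z" if "z \<in> W" for i z
    using partial_cong[OF assms(1) that assms(3)] .
  have "partial i (partial j F) x = partial i (partial j G) x" for i j
    using partial_cong[OF assms(1,2) 1] .
  then show ?thesis
    using 1[OF assms(2)] by (simp add: normal_trace_hessian_def trace_hessian_def first_form_def)
qed

lemma param_in: "x \<in> snd c ` fst c \<Longrightarrow> param c x \<in> fst c"
  by (simp add: param_def inv_into_into)

lemma chart_param: "x \<in> snd c ` fst c \<Longrightarrow> snd c (param c x) = x"
  by (simp add: param_def f_inv_into_f)

lemma metric_lorentz_submanifold [simp]: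
  "metric (lorentz_submanifold S) d =
    (\<lambda>y v w. lorentz (frechet_derivative (param d) (at y) v) (frechet_derivative (param d) (at y) w))"
  by (simp add: lorentz_submanifold_def)

lemma mtop_lorentz_submanifold [simp]: "mtop (lorentz_submanifold S) = top_of_set S"
  by (simp add: lorentz_submanifold_def)

lemma atlas_lorentz_submanifoldD:
  assumes "d \<in> atlas (lorentz_submanifold S)"
  shows "openin (top_of_set S) (fst d)" "open (snd d ` fst d)"
    "homeomorphism (fst d) (snd d ` fst d) (snd d) (param d)"
    "smooth_on (snd d ` fst d) (param d)"
    "y \<in> snd d ` fst d \<Longrightarrow> inj (frechet_derivative (param d) (at y))"
  using assms by (simp_all add: lorentz_submanifold_def) blast

lemma param_chart:
  "d \<in> atlas (lorentz_submanifold S) \<Longrightarrow> p \<in> fst d \<Longrightarrow> param d (snd d p) = p"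
  by (rule homeomorphism_apply1[OF atlas_lorentz_submanifoldD(3)])

text \<open>A linear left inverse \<open>Q\<close> of the parametrization serves as coordinate map.
  It is continuous, and differentiating Q (P y) = y shows that the derivative of \<open>P\<close> is
  injective.\<close>

lemma lift_chart_in_atlas:
  fixes P :: "real^'k::finite \<Rightarrow> real \<times> (real^'d)"
  assumes "open U" "smooth_on U P" "bounded_linear Q" "\<And>y. y \<in> U \<Longrightarrow> Q (P y) = y"
    and "open T" "P ` U = S \<inter> T"
  shows "(S \<inter> T, Q) \<in> atlas (lorentz_submanifold S)"
proof -
  have img: "Q ` (S \<inter> T) = U"
    unfolding assms(6)[symmetric] using assms(4) by (auto simp: image_image image_iff)
  have inj: "inj_on Q (S \<inter> T)"
    unfolding assms(6)[symmetric] inj_on_def using assms(4) by (metis imageE)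
  have param: "param (S \<inter> T, Q) y = P y" if "y \<in> U" for y
  proof -
    have "P y \<in> S \<inter> T" using that assms(6) by blast
    from inv_into_f_f[OF inj this] show ?thesis
      by (simp add: param_def assms(4)[OF that])
  qed
  have D: "frechet_derivative (param (S \<inter> T, Q)) (at y) = frechet_derivative P (at y)" if "y \<in> U" for y
    using frechet_derivative_cong[OF assms(1) that param] .
  have "homeomorphism (S \<inter> T) U Q (param (S \<inter> T, Q))"
  proof
    show "continuous_on (S \<inter> T) Q" using assms(3) by (rule bounded_linear.continuous_on) simp
    have "continuous_on U P" using assms(2) unfolding smooth_on_def by (metis Ck_on.simps(1))
    then show "continuous_on U (param (S \<inter> T, Q))" using param by (simp cong: continuous_on_cong)
    show "param (S \<inter> T, Q) ` U \<subseteq> S \<inter> T" using assms(6) param by auto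
    show "Q (param (S \<inter> T, Q) y) = y" if "y \<in> U" for y using that param assms(4) by simp
    show "param (S \<inter> T, Q) (Q p) = p" if "p \<in> S \<inter> T" for p
      using that inj by (simp add: param_def)
  qed (use img in auto)
  moreover have "smooth_on U (param (S \<inter> T, Q))"
    using assms(2) Ck_on_cong_imp[OF assms(1), of P] param unfolding smooth_on_def by auto
  moreover have "inj (frechet_derivative P (at y))" if y: "y \<in> U" for y
  proof -
    have "((\<lambda>z. Q (P z)) has_derivative (\<lambda>v. Q (frechet_derivative P (at y) v))) (at y)"
      using bounded_linear.has_derivative[OF assms(3) smooth_on_has_derivative[OF assms(2,1) y]] .
    then have "((\<lambda>z. z) has_derivative (\<lambda>v. Q (frechet_derivative P (at y) v))) (at y)"
      by (rule has_derivative_transform_within_open[OF _ assms(1) y]) (rule assms(4))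
    then have "(\<lambda>v. Q (frechet_derivative P (at y) v)) = (\<lambda>v. v)"
      using has_derivative_unique has_derivative_ident by blast
    then show ?thesis by (metis injI)
  qed
  ultimately show ?thesis
    using img assms(1,5) D by (auto simp: lorentz_submanifold_def openin_open_Int)
qed

section \<open>Maps into submanifolds of Minkowski space\<close>

text \<open>\<open>T\<close> gives the tangent spaces as subsets of Minkowski space. The cylinder
  and the slices are the two instances, and the criteria proved here mention charts of
  \<open>M\<close> only, so they can be compared.\<close>

locale map_to_submanifold =
  fixes M :: "('a, 'm::finite, 'y) manifold_scheme" and S :: "(real \<times> (real^'d)) set"
    and T :: "real \<times> (real^'d) \<Rightarrow> (real \<times> (real^'d)) set"
    and N :: "(real \<times> (real^'d), 'k::finite) semi_riemannian" and \<psi> :: "'a \<Rightarrow> real \<times> (real^'d)"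
  assumes M: "smooth_manifold M"
    and N_def: "N = lorentz_submanifold S"
    and atlas_covers: "p \<in> S \<Longrightarrow> \<exists>d\<in>atlas N. p \<in> fst d"
    and tangent: "d \<in> atlas N \<Longrightarrow> y \<in> snd d ` fst d \<Longrightarrow> range (frechet_derivative (param d) (at y)) = T (param d y)"
    and nondegenerate: "p \<in> S \<Longrightarrow> v \<in> T p \<Longrightarrow> (\<And>w. w \<in> T p \<Longrightarrow> lorentz v w = 0) \<Longrightarrow> v = 0"
begin

abbreviation "V c \<equiv> snd c ` fst c"

lemma open_V: "c \<in> atlas M \<Longrightarrow> open (V c)"
  using M by (simp add: smooth_manifold_def)

lemma chart_homeomorphic: "c \<in> atlas M \<Longrightarrow>
    homeomorphic_map (subtopology (mtop M) (fst c)) (top_of_set (V c)) (snd c)"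
  using M by (simp add: smooth_manifold_def)

lemma fst_chart: "c \<in> atlas M \<Longrightarrow> openin (mtop M) (fst c)"
  using M by (simp add: smooth_manifold_def)

text \<open>The homeomorphism property supplies some continuous inverse; injectivity of the chart
  identifies it with the \<open>inv_into\<close> behind \<open>param\<close>.\<close>

lemma continuous_param:
  assumes "c \<in> atlas M"
  shows "continuous_map (top_of_set (V c)) (mtop M) (param c)"
proof -
  obtain g where g: "homeomorphic_maps (subtopology (mtop M) (fst c)) (top_of_set (V c)) (snd c) g"
    using chart_homeomorphic[OF assms] homeomorphic_map_maps by blast
  have inj: "inj_on (snd c) (fst c)"
    using homeomorphic_imp_injective_map[OF chart_homeomorphic[OF assms]]
      openin_subset[OF fst_chart[OF assms]] by (simp add: Int_absorb1)
  have cont: "continuous_map (top_of_set (V c)) (subtopology (mtop M) (fst c)) g"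
    using g by (simp add: homeomorphic_maps_def)
  have "g x = param c x" if "x \<in> V c" for x
  proof -
    have "g x \<in> fst c" using cont that continuous_map_image_subset_topspace by fastforce
    moreover have "snd c (g x) = x" using g that by (auto simp: homeomorphic_maps_def)
    ultimately show ?thesis using inj param_in[OF that] chart_param[OF that] by (metis inj_onD)
  qed
  then show ?thesis
    using continuous_map_eq[OF continuous_map_into_fulltopology[OF cont]] by simp
qed

lemma loc_dom_subset: "loc_dom \<psi> c d \<subseteq> V c"
  by (auto simp: loc_dom_def)

lemma param_chart_M: 
  assumes "c \<in> atlas M" "p \<in> fst c"
  shows "param c (snd c p) = p"
proof -
  have "inj_on (snd c) (fst c)"
    using homeomorphic_imp_injective_map[OF chart_homeomorphic[OF assms(1)]]
      openin_subset[OF fst_chart[OF assms(1)]] by (simp add: Int_absorb1)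
  then show ?thesis using assms(2) by (simp add: param_def)
qed

lemma loc_domD:
  assumes "c \<in> atlas M" "d \<in> atlas N" "x \<in> loc_dom \<psi> c d"
  shows "\<psi> (param c x) \<in> fst d" "loc_rep \<psi> c d x \<in> V d" "param d (loc_rep \<psi> c d x) = \<psi> (param c x)"
proof -
  obtain p where p: "x = snd c p" "p \<in> fst c" "\<psi> p \<in> fst d"
    using assms(3) unfolding loc_dom_def by blast
  then show *: "\<psi> (param c x) \<in> fst d"
    using param_chart_M[OF assms(1)] by simp
  then show "loc_rep \<psi> c d x \<in> V d" "param d (loc_rep \<psi> c d x) = \<psi> (param c x)"
    using param_chart[OF assms(2)[unfolded N_def]] by (simp_all add: loc_rep_def)
qed

context
  assumes cont: "continuous_map (mtop M) (top_of_set S) \<psi>"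
begin

lemma continuous_F: "c \<in> atlas M \<Longrightarrow> continuous_on (V c) (\<psi> \<circ> param c)"
  using continuous_map_compose[OF continuous_param cont]
  by (simp add: continuous_map_in_subtopology)

lemma F_in_S: "c \<in> atlas M \<Longrightarrow> x \<in> V c \<Longrightarrow> \<psi> (param c x) \<in> S"
  using continuous_map_image_subset_topspace[OF continuous_map_compose[OF continuous_param cont]]
  by fastforce

lemma open_loc_dom:
  assumes "c \<in> atlas M" "d \<in> atlas N"
  shows "open (loc_dom \<psi> c d)"
proof -
  have "openin (mtop M) {p \<in> topspace (mtop M). \<psi> p \<in> fst d}"
    using atlas_lorentz_submanifoldD(1)[of d S] assms(2) cont
    by (auto simp: N_def intro: openin_continuous_map_preimage)
  then have "openin (mtop M) (fst c \<inter> {p \<in> topspace (mtop M). \<psi> p \<in> fst d})"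
    using fst_chart[OF assms(1)] by blast
  moreover have "fst c \<inter> {p \<in> topspace (mtop M). \<psi> p \<in> fst d} = fst c \<inter> \<psi> -` fst d"
    using openin_subset[OF fst_chart[OF assms(1)]] by auto
  ultimately have "openin (subtopology (mtop M) (fst c)) (fst c \<inter> \<psi> -` fst d)"
    by (metis inf.cobounded1 openin_subtopology_Int2 openin_open_subtopology fst_chart[OF assms(1)])
  then have "openin (top_of_set (V c)) (loc_dom \<psi> c d)"
    unfolding loc_dom_def
    using homeomorphic_imp_open_map[OF chart_homeomorphic[OF assms(1)]] by (auto simp: open_map_def)
  then show ?thesis using open_V[OF assms(1)] openin_open_eq by blast
qed

lemma ex_chart:
  assumes "c \<in> atlas M" "x \<in> V c"
  shows "\<exists>d\<in>atlas N. x \<in> loc_dom \<psi> c d"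
proof -
  obtain d where "d \<in> atlas N" "\<psi> (param c x) \<in> fst d"
    using atlas_covers[OF F_in_S[OF assms]] by blast
  then show ?thesis
    using param_in[OF assms(2)] chart_param[OF assms(2)] by (force simp: loc_dom_def)
qed

text \<open>The ambient charts cover \<open>S\<close>; hence a condition that does not mention the
  ambient chart can be moved to the whole coordinate domain.\<close>

lemma ball_loc_dom_iff:
  assumes "c \<in> atlas M"
  shows "(\<forall>d\<in>atlas N. \<forall>x\<in>loc_dom \<psi> c d. A x) \<longleftrightarrow> (\<forall>x\<in>V c. A x)"
  using ex_chart[OF assms] loc_dom_subset by blast

lemma local_lift:
  assumes "c \<in> atlas M" "d \<in> atlas N" "smooth_on (loc_dom \<psi> c d) (loc_rep \<psi> c d)"
  shows "local_lift (param d) (loc_rep \<psi> c d) (V d) (loc_dom \<psi> c d)"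
proof
  note D = atlas_lorentz_submanifoldD[OF assms(2)[unfolded N_def]]
  show "open (V d)" "smooth_on (V d) (param d)" by (fact D)+
  show "open (loc_dom \<psi> c d)" by (rule open_loc_dom[OF assms(1,2)])
  show "loc_rep \<psi> c d x \<in> V d" if "x \<in> loc_dom \<psi> c d" for x
    by (rule loc_domD(2)[OF assms(1,2) that])
qed (fact assms(3))

text \<open>From coordinates to Minkowski space one composes with \<open>param d\<close> and uses
  locality. In the other direction \<open>smooth_on_lift\<close> recovers the coordinate
  representation.\<close>

lemma smooth_loc_rep_iff:
  assumes "c \<in> atlas M"
  shows "(\<forall>d\<in>atlas N. smooth_on (loc_dom \<psi> c d) (loc_rep \<psi> c d)) \<longleftrightarrow> smooth_on (V c) (\<psi> \<circ> param c)"
proof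
  assume sm: "\<forall>d\<in>atlas N. smooth_on (loc_dom \<psi> c d) (loc_rep \<psi> c d)"
  show "smooth_on (V c) (\<psi> \<circ> param c)"
    unfolding smooth_on_def
  proof (intro allI Ck_on_local)
    fix k x assume "x \<in> V c"
    then obtain d where d: "d \<in> atlas N" "x \<in> loc_dom \<psi> c d" using ex_chart[OF assms] by blast
    interpret local_lift "param d" "loc_rep \<psi> c d" "V d" "loc_dom \<psi> c d"
      by (rule local_lift[OF assms d(1)]) (rule bspec[OF sm d(1)])
    have "Ck_on k (loc_dom \<psi> c d) (\<lambda>x. param d (loc_rep \<psi> c d x))"
    proof (rule Ck_on_compose[OF W U])
      show "loc_rep \<psi> c d ` loc_dom \<psi> c d \<subseteq> V d" using u_in by (rule image_subsetI)
    qed (use smooth_u smooth_P in \<open>simp_all add: smooth_on_def\<close>)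
    then have "Ck_on k (loc_dom \<psi> c d) (\<psi> \<circ> param c)"
      by (rule Ck_on_cong_imp[OF W, rotated]) (simp add: loc_domD[OF assms d(1)])
    then show "\<exists>T. open T \<and> x \<in> T \<and> Ck_on k T (\<psi> \<circ> param c)"
      using W d(2) by (intro exI[of _ "loc_dom \<psi> c d"] conjI)
  qed
next
  assume F: "smooth_on (V c) (\<psi> \<circ> param c)"
  show "\<forall>d\<in>atlas N. smooth_on (loc_dom \<psi> c d) (loc_rep \<psi> c d)"
  proof
    fix d assume d: "d \<in> atlas N"
    note D = atlas_lorentz_submanifoldD[OF d[unfolded N_def]]
    note W = open_loc_dom[OF assms d]
    show "smooth_on (loc_dom \<psi> c d) (loc_rep \<psi> c d)"
    proof (rule smooth_on_lift[where P = "param d", OF D(2) W])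
      show "loc_rep \<psi> c d ` loc_dom \<psi> c d \<subseteq> V d" using loc_domD[OF assms d] by auto
      have F_cont: "continuous_on (loc_dom \<psi> c d) (\<psi> \<circ> param c)"
        using continuous_F[OF assms] loc_dom_subset by (rule continuous_on_subset)
      have "continuous_on (fst d) (snd d)" using D(3) by (simp add: homeomorphism_def)
      from continuous_on_compose2[OF this F_cont]
      have "continuous_on (loc_dom \<psi> c d) (\<lambda>x. snd d ((\<psi> \<circ> param c) x))"
        using loc_domD(1)[OF assms d] by auto
      then show "continuous_on (loc_dom \<psi> c d) (loc_rep \<psi> c d)" by (simp add: loc_rep_def o_def)
      show "smooth_on (loc_dom \<psi> c d) (\<lambda>x. param d (loc_rep \<psi> c d x))"
        unfolding smooth_on_def
      proof
        fix k
        have "Ck_on k (loc_dom \<psi> c d) (\<psi> \<circ> param c)"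
          using F loc_dom_subset unfolding smooth_on_def by (blast intro: Ck_on_subset)
        then show "Ck_on k (loc_dom \<psi> c d) (\<lambda>x. param d (loc_rep \<psi> c d x))"
          by (rule Ck_on_cong_imp[OF W, rotated]) (simp add: loc_domD[OF assms d])
      qed
    qed (use D in auto)
  qed
qed

end

lemma smooth_map_iff:
  "smooth_map M N \<psi> \<longleftrightarrow> continuous_map (mtop M) (top_of_set S) \<psi> \<and>
    (\<forall>c\<in>atlas M. smooth_on (V c) (\<psi> \<circ> param c))"
proof -
  have "mtop N = top_of_set S" by (simp add: N_def)
  then show ?thesis
    using smooth_loc_rep_iff unfolding smooth_map_def by (simp cong: conj_cong ball_cong)
qed

context
  assumes smooth: "smooth_map M N \<psi>"
begin

lemma smooth_map_continuous: "continuous_map (mtop M) (top_of_set S) \<psi>"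
  using smooth unfolding smooth_map_iff by (rule conjunct1)

lemma local_lift_smooth:
  "c \<in> atlas M \<Longrightarrow> d \<in> atlas N \<Longrightarrow> local_lift (param d) (loc_rep \<psi> c d) (V d) (loc_dom \<psi> c d)"
  using smooth by (intro local_lift[OF smooth_map_continuous]) (auto simp: smooth_map_def)

lemma F_frechet_derivative:
  assumes "c \<in> atlas M" "d \<in> atlas N" "x \<in> loc_dom \<psi> c d"
  shows "frechet_derivative (\<psi> \<circ> param c) (at x) =
    frechet_derivative (\<lambda>x. param d (loc_rep \<psi> c d x)) (at x)"
  using open_loc_dom[OF smooth_map_continuous assms(1,2)] assms(3)
  by (rule frechet_derivative_cong) (simp add: loc_domD[OF assms(1,2)])

lemma inj_loc_rep_iff:
  assumes "c \<in> atlas M" "d \<in> atlas N" "x \<in> loc_dom \<psi> c d"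
  shows "inj (frechet_derivative (loc_rep \<psi> c d) (at x)) \<longleftrightarrow> inj (frechet_derivative (\<psi> \<circ> param c) (at x))"
proof -
  interpret local_lift "param d" "loc_rep \<psi> c d" "V d" "loc_dom \<psi> c d"
    by (rule local_lift_smooth[OF assms(1,2)])
  have "inj (DP (loc_rep \<psi> c d x))"
    using atlas_lorentz_submanifoldD(5)[OF assms(2)[unfolded N_def] u_in[OF assms(3)]] .
  from inj_eq[OF this] show ?thesis
    unfolding F_frechet_derivative[OF assms] inj_def F_frechet[OF assms(3)] by simp
qed

lemma induced_metric_F:
  assumes "c \<in> atlas M" "d \<in> atlas N" "x \<in> loc_dom \<psi> c d"
  shows "induced_metric N \<psi> c d x v w =
    lorentz (frechet_derivative (\<psi> \<circ> param c) (at x) v) (frechet_derivative (\<psi> \<circ> param c) (at x) w)"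
proof -
  interpret local_lift "param d" "loc_rep \<psi> c d" "V d" "loc_dom \<psi> c d"
    by (rule local_lift_smooth[OF assms(1,2)])
  show ?thesis
    unfolding F_frechet_derivative[OF assms]
    by (simp add: induced_metric_def Let_def N_def F_frechet[OF assms(3)])
qed

text \<open>As \<open>w\<close> runs through all chart components, its image under the derivative of
  \<open>param d\<close> runs through \<open>T\<close>; this removes the ambient chart from the
  criterion.\<close>

lemma mean_curvature_F:
  assumes "c \<in> atlas M" "d \<in> atlas N" "x \<in> loc_dom \<psi> c d"
  shows "mean_curvature N \<psi> c d x = 0 \<longleftrightarrow>
    (\<forall>w \<in> T (\<psi> (param c x)). lorentz (normal_trace_hessian (\<psi> \<circ> param c) x) w = 0)"
proof -
  interpret local_lift "param d" "loc_rep \<psi> c d" "V d" "loc_dom \<psi> c d"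
    by (rule local_lift_smooth[OF assms(1,2)])
  let ?y = "loc_rep \<psi> c d x"
  have T: "range (DP ?y) = T (\<psi> (param c x))"
    using tangent[OF assms(2) u_in[OF assms(3)]] loc_domD(3)[OF assms] by simp
  have met: "metric N d = (\<lambda>y v w. lorentz (DP y v) (DP y w))" by (simp add: N_def)
  have nd: "v = 0" if "\<And>w. metric N d ?y v w = 0" for v
  proof -
    have "lorentz (DP ?y v) w = 0" if "w \<in> T (\<psi> (param c x))" for w
      using \<open>\<And>w. metric N d ?y v w = 0\<close> that unfolding T[symmetric] met by auto
    moreover have "DP ?y v \<in> T (\<psi> (param c x))" unfolding T[symmetric] by simp
    moreover have "\<psi> (param c x) \<in> S"
      using F_in_S[OF smooth_map_continuous assms(1)] assms(3) loc_dom_subset by blast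
    ultimately have "DP ?y v = 0" using nondegenerate by blast
    also have "0 = DP ?y 0"
      using linear_0[OF has_derivative_linear[OF P_deriv[OF u_in[OF assms(3)]]]] by simp
    finally show "v = 0"
      using injD[OF atlas_lorentz_submanifoldD(5)[OF assms(2)[unfolded N_def] u_in[OF assms(3)]]] by blast
  qed
  have eq: "normal_trace_hessian (\<psi> \<circ> param c) x = normal_trace_hessian F x"
    by (rule normal_trace_hessian_cong[OF W assms(3)]) (simp add: loc_domD[OF assms(1,2)])
  have "mean_curvature N \<psi> c d x = 0 \<longleftrightarrow> (\<forall>w. lorentz (normal_trace_hessian F x) (DP ?y w) = 0)"
    by (rule mean_curvature_eq_0_iff[OF met refl assms(3) nd])
  then show ?thesis unfolding eq T[symmetric] by auto
qed

end

text \<open>\<open>S\<close> enters the right-hand side through continuity only, so passing between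
  Q(1) and a slice just changes the codomain of a continuous map.\<close>

lemma immersion_iff:
  "immersion M N \<psi> \<longleftrightarrow> continuous_map (mtop M) (top_of_set S) \<psi> \<and>
    (\<forall>c\<in>atlas M. smooth_on (V c) (\<psi> \<circ> param c) \<and>
      (\<forall>x\<in>V c. inj (frechet_derivative (\<psi> \<circ> param c) (at x))))"
proof (cases "smooth_map M N \<psi>")
  case True
  have "(\<forall>d\<in>atlas N. \<forall>x\<in>loc_dom \<psi> c d. inj (frechet_derivative (loc_rep \<psi> c d) (at x))) \<longleftrightarrow>
      (\<forall>x\<in>V c. inj (frechet_derivative (\<psi> \<circ> param c) (at x)))" if "c \<in> atlas M" for c
    unfolding ball_loc_dom_iff[OF smooth_map_continuous[OF True] that, symmetric]
    using inj_loc_rep_iff[OF True that] by simp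
  then show ?thesis using True[unfolded smooth_map_iff] True unfolding immersion_def by simp
qed (auto simp: immersion_def smooth_map_iff)

lemma spacelike_submanifold_iff:
  "spacelike_submanifold M N \<psi> \<longleftrightarrow> immersion M N \<psi> \<and>
    (\<forall>c\<in>atlas M. \<forall>x\<in>V c. \<forall>v. v \<noteq> 0 \<longrightarrow>
      lorentz (frechet_derivative (\<psi> \<circ> param c) (at x) v) (frechet_derivative (\<psi> \<circ> param c) (at x) v) > 0)"
proof (cases "immersion M N \<psi>")
  case True
  then have sm: "smooth_map M N \<psi>" by (simp add: immersion_def)
  have "(\<forall>d\<in>atlas N. \<forall>x\<in>loc_dom \<psi> c d. \<forall>v. v \<noteq> 0 \<longrightarrow> induced_metric N \<psi> c d x v v > 0) \<longleftrightarrow>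
      (\<forall>x\<in>V c. \<forall>v. v \<noteq> 0 \<longrightarrow>
      lorentz (frechet_derivative (\<psi> \<circ> param c) (at x) v) (frechet_derivative (\<psi> \<circ> param c) (at x) v) > 0)"
    if "c \<in> atlas M" for c
    unfolding ball_loc_dom_iff[OF smooth_map_continuous[OF sm] that, symmetric]
    using induced_metric_F[OF sm that] by simp
  then show ?thesis using True unfolding spacelike_submanifold_def by simp
qed (simp add: spacelike_submanifold_def)

lemma stationary_iff:
  assumes "immersion M N \<psi>"
  shows "stationary M N \<psi> \<longleftrightarrow> (\<forall>c\<in>atlas M. \<forall>x\<in>V c. \<forall>w \<in> T (\<psi> (param c x)).
    lorentz (normal_trace_hessian (\<psi> \<circ> param c) x) w = 0)"
proof -
  have sm: "smooth_map M N \<psi>" using assms by (simp add: immersion_def)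
  have "(\<forall>d\<in>atlas N. \<forall>x\<in>loc_dom \<psi> c d. mean_curvature N \<psi> c d x = 0) \<longleftrightarrow>
      (\<forall>x\<in>V c. \<forall>w \<in> T (\<psi> (param c x)). lorentz (normal_trace_hessian (\<psi> \<circ> param c) x) w = 0)"
    if "c \<in> atlas M" for c
    unfolding ball_loc_dom_iff[OF smooth_map_continuous[OF sm] that, symmetric]
    using mean_curvature_F[OF sm that] by simp
  then show ?thesis
    unfolding stationary_def by simp
qed

end

section \<open>Charts of the cylinder and of its slices\<close>

lemma Ck_on_ident: "open S \<Longrightarrow> Ck_on k S (\<lambda>x. x)"
proof (induction k)
  case (Suc k)
  then show ?case by (intro Ck_on_SucI[where f' = "\<lambda>x v. v"] Ck_on_const) auto
qed simp

definition cylinder :: "(real \<times> (real^'d)) set" where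
  "cylinder = {p. snd p \<bullet> snd p = 1}"

definition slice_set :: "real \<Rightarrow> (real \<times> (real^'d)) set" where
  "slice_set t0 = {p. fst p = t0 \<and> snd p \<bullet> snd p = 1}"

lemma static_einstein_eq:
  "static_einstein = (lorentz_submanifold cylinder :: (real \<times> (real^'d::finite), 'd) semi_riemannian)"
proof -
  have "{(t, x). (\<Sum>i\<in>UNIV. (x $ i)\<^sup>2) = 1} = (cylinder :: (real \<times> (real^'d)) set)"
    by (auto simp: cylinder_def inner_vec_def power2_eq_square)
  then show ?thesis by (simp add: static_einstein_def)
qed

lemma slice_eq:
  "slice t0 = (lorentz_submanifold (slice_set t0) :: (real \<times> (real^'d::finite), 'n::finite) semi_riemannian)"
proof -
  have "{t0} \<times> {x. (\<Sum>i\<in>UNIV. (x $ i)\<^sup>2) = 1} = (slice_set t0 :: (real \<times> (real^'d)) set)"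
    by (auto simp: slice_set_def inner_vec_def power2_eq_square)
  then show ?thesis by (simp add: slice_def)
qed

text \<open>The graph of the height function of a half sphere over the hyperplane \<open>x\<^sub>k = 0\<close>; the
  free \<open>k\<close>-th coordinate holds the time.\<close>

definition graph_lift :: "'d \<Rightarrow> real \<Rightarrow> real^'d \<Rightarrow> real \<times> (real^'d::finite)" where
  "graph_lift k \<sigma> y =
    (y $ k, \<chi> i. if i = k then \<sigma> * sqrt (1 - (\<Sum>j\<in>UNIV-{k}. y $ j * y $ j)) else y $ i)"

definition graph_dom :: "'d \<Rightarrow> (real^'d::finite) set" where
  "graph_dom k = {y. (\<Sum>j\<in>UNIV-{k}. y $ j * y $ j) < 1}"

lemma open_graph_dom: "open (graph_dom k)"
  unfolding graph_dom_def by (intro open_Collect_less continuous_intros)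

lemma smooth_graph_lift: "smooth_on (graph_dom k) (graph_lift k \<sigma>)"
  unfolding smooth_on_def
proof
  fix m
  note [intro] = Ck_on_vec_nth[OF open_graph_dom Ck_on_ident[OF open_graph_dom]]
  have "Ck_on m (graph_dom k) (\<lambda>y. 1 + (-1) * (\<Sum>j\<in>UNIV-{k}. y $ j * y $ j))"
    by (intro Ck_on_add Ck_on_mult Ck_on_sum Ck_on_const open_graph_dom) auto
  then have "Ck_on m (graph_dom k) (\<lambda>y. \<sigma> * sqrt (1 + (-1) * (\<Sum>j\<in>UNIV-{k}. y $ j * y $ j)))"
    by (intro Ck_on_mult Ck_on_sqrt Ck_on_const open_graph_dom) (simp add: graph_dom_def)
  then have "Ck_on m (graph_dom k) (\<lambda>y. (\<chi> i. if i = k then \<sigma> * sqrt (1 - (\<Sum>j\<in>UNIV-{k}. y $ j * y $ j)) else y $ i) $ i)" for i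
    by (cases "i = k") auto
  then show "Ck_on m (graph_dom k) (graph_lift k \<sigma>)"
    unfolding graph_lift_def[abs_def]
    by (intro Ck_on_Pair Ck_on_vec open_graph_dom) auto
qed

text \<open>The equation of the cylinder determines the \<open>k\<close>-th space coordinate up to
  sign, and the sign \<open>\<sigma>\<close> selects the root.\<close>

lemma graph_lift_image:
  fixes k :: "'d::finite"
  assumes "\<sigma> * \<sigma> = 1"
  shows "graph_lift k \<sigma> ` graph_dom k = cylinder \<inter> {p. \<sigma> * snd p $ k > 0}"
proof (intro equalityI subsetI)
  have sq: "x \<bullet> x = x $ k * x $ k + (\<Sum>j\<in>UNIV-{k}. x $ j * x $ j)" for x :: "real^'d"
    by (simp add: inner_vec_def sum.remove[of UNIV k])
  {
    fix p assume "p \<in> graph_lift k \<sigma> ` graph_dom k"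
    then obtain y where y: "y \<in> graph_dom k" "p = graph_lift k \<sigma> y" by blast
    define r where "r = (\<Sum>j\<in>UNIV-{k}. y $ j * y $ j)"
    have r: "1 - r > 0" using y(1) by (simp add: graph_dom_def r_def)
    have k: "snd p $ k = \<sigma> * sqrt (1 - r)" by (simp add: y(2) graph_lift_def r_def)
    have "(\<Sum>j\<in>UNIV-{k}. snd p $ j * snd p $ j) = r"
      unfolding r_def by (rule sum.cong) (auto simp: y(2) graph_lift_def)
    then have "snd p \<bullet> snd p = (\<sigma> * \<sigma>) * (sqrt (1 - r) * sqrt (1 - r)) + r"
      by (simp add: sq k mult_ac)
    then have "p \<in> cylinder" using r assms by (simp add: cylinder_def)
    moreover have "\<sigma> * snd p $ k > 0" using r assms by (simp add: k mult.assoc[symmetric])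
    ultimately show "p \<in> cylinder \<inter> {p. \<sigma> * snd p $ k > 0}" by simp
  next
    fix p :: "real \<times> (real^'d)" assume p: "p \<in> cylinder \<inter> {p. \<sigma> * snd p $ k > 0}"
    define x where "x = snd p"
    \<comment> \<open>Slot \<open>k\<close> carries the time, since the space coordinate that
      belongs there can be recovered.\<close>
    define y where "y = (\<chi> i. if i = k then fst p else x $ i)"
    define r where "r = (\<Sum>j\<in>UNIV-{k}. x $ j * x $ j)"
    have pos: "\<sigma> * x $ k > 0" using p by (simp add: x_def)
    have r: "1 - r = x $ k * x $ k" using p sq[of x] by (simp add: cylinder_def x_def r_def)
    also have "\<dots> = (\<sigma> * \<sigma>) * (x $ k * x $ k)" using assms by simp
    also have "\<dots> = (\<sigma> * x $ k) * (\<sigma> * x $ k)" by (simp add: mult_ac)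
    finally have r2: "1 - r = (\<sigma> * x $ k) * (\<sigma> * x $ k)" .
    have ry: "(\<Sum>j\<in>UNIV-{k}. y $ j * y $ j) = r"
      unfolding r_def by (rule sum.cong) (auto simp: y_def)
    have "1 - r > 0" unfolding r2 using pos by (rule mult_pos_pos) (rule pos)
    then have "y \<in> graph_dom k" by (simp add: graph_dom_def ry)
    moreover have "sqrt (1 - r) = \<sigma> * x $ k"
      unfolding r2 real_sqrt_abs2 using pos by simp
    then have "\<sigma> * sqrt (1 - r) = x $ k"
      using assms by (simp add: mult.assoc[symmetric])
    then have "graph_lift k \<sigma> y = p"
      unfolding graph_lift_def ry by (auto simp: prod_eq_iff vec_eq_iff y_def x_def)
    ultimately show "p \<in> graph_lift k \<sigma> ` graph_dom k" by blast
  }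
qed

lemma open_half_space: "open {p :: real \<times> (real^'d). \<sigma> * snd p $ k > 0}"
  by (intro open_Collect_less continuous_intros)

lemma ex_half_space:
  assumes "snd p \<bullet> snd p = 1"
  obtains k \<sigma> where "\<sigma> * \<sigma> = 1" "\<sigma> * snd (p :: real \<times> (real^'d)) $ k > 0"
proof -
  have "snd p \<noteq> 0" using assms by auto
  then obtain k where "snd p $ k \<noteq> 0" by (auto simp: vec_eq_iff)
  then show ?thesis using that[of "sgn (snd p $ k)" k] by (auto simp: sgn_if split: if_splits)
qed

lemma cylinder_atlas_covers:
  assumes "p \<in> cylinder"
  shows "\<exists>d\<in>atlas (lorentz_submanifold cylinder :: (real \<times> (real^'d), 'd::finite) semi_riemannian). p \<in> fst d"
proof -
  have "snd p \<bullet> snd p = 1" using assms by (simp add: cylinder_def)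
  then obtain k \<sigma> where \<sigma>: "\<sigma> * \<sigma> = 1" "\<sigma> * snd p $ k > 0"
    by (rule ex_half_space)
  \<comment> \<open>\<open>Q\<close> undoes the graph parametrization by writing the time into slot
    \<open>k\<close>; it is linear on the whole Minkowski space.\<close>
  define Q where "Q p = (\<chi> i. if i = k then fst p else snd p $ i)" for p :: "real \<times> (real^'d)"
  have "bounded_linear Q" unfolding linear_conv_bounded_linear[symmetric] Q_def
    by (rule linearI) (auto simp: vec_eq_iff)
  moreover have "Q (graph_lift k \<sigma> y) = y" for y by (simp add: Q_def graph_lift_def vec_eq_iff)
  ultimately have "(cylinder \<inter> {p. \<sigma> * snd p $ k > 0}, Q) \<in> atlas (lorentz_submanifold cylinder)"
    by (rule lift_chart_in_atlas[OF open_graph_dom smooth_graph_lift _ _ open_half_space graph_lift_image[OF \<sigma>(1)]])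
  then show ?thesis by (rule bexI[rotated]) (use assms \<sigma>(2) in simp)
qed

text \<open>A chart of the slice arises from a graph chart of the cylinder by freezing the time slot
  at \<open>t0\<close>.\<close>

lemma slice_atlas_covers:
  fixes p :: "real \<times> (real^'d::finite)"
  assumes dim: "CARD('d) = CARD('n::finite) + 1" and "p \<in> slice_set t0"
  shows "\<exists>d\<in>atlas (lorentz_submanifold (slice_set t0) :: (real \<times> (real^'d), 'n) semi_riemannian). p \<in> fst d"
proof -
  have "snd p \<bullet> snd p = 1" using assms(2) by (simp add: slice_set_def)
  then obtain k \<sigma> where \<sigma>: "\<sigma> * \<sigma> = 1" "\<sigma> * snd p $ k > 0"
    by (rule ex_half_space)
  \<comment> \<open>By the dimension hypothesis the coordinates other than \<open>k\<close> can be
    indexed by \<open>'n\<close>.\<close>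
  have "card (UNIV - {k}) = card (UNIV :: 'n set)" using dim by (simp add: card_Diff_singleton)
  then obtain \<tau> :: "'n \<Rightarrow> 'd" where \<tau>: "bij_betw \<tau> UNIV (UNIV - {k})"
    by (metis finite finite_same_card_bij)
  define \<rho> where "\<rho> = inv \<tau>"
  have \<rho>\<tau>: "\<rho> (\<tau> a) = a" for a using \<tau> by (simp add: \<rho>_def bij_betw_def)
  have \<tau>\<rho>: "\<tau> (\<rho> i) = i" if "i \<noteq> k" for i
    using that \<tau> unfolding \<rho>_def bij_betw_def by (metis DiffI UNIV_I f_inv_into_f singletonD)
  have \<tau>k: "\<tau> a \<noteq> k" for a using \<tau> by (auto simp: bij_betw_def)
  define \<iota> where "\<iota> z = (\<chi> i. if i = k then t0 else z $ \<rho> i)" for z :: "real^'n"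
  define P where "P z = graph_lift k \<sigma> (\<iota> z)" for z
  define U where "U = \<iota> -` graph_dom k"
  define Q where "Q p = (\<chi> a. snd p $ \<tau> a)" for p :: "real \<times> (real^'d)"
  have \<iota>_Ck: "Ck_on m S \<iota>" if "open S" for m S
  proof (rule Ck_on_vec[OF that])
    show "Ck_on m S (\<lambda>x. \<iota> x $ i)" for i
      using that by (cases "i = k") (auto simp: \<iota>_def intro: Ck_on_vec_nth Ck_on_ident)
  qed
  have "continuous_on UNIV \<iota>" using \<iota>_Ck[of UNIV 0] by simp
  then have U: "open U" unfolding U_def by (rule open_vimage[OF open_graph_dom])
  have "smooth_on U P"
    unfolding smooth_on_def P_def
  proof
    show "Ck_on m U (\<lambda>z. graph_lift k \<sigma> (\<iota> z))" for m
      using smooth_graph_lift by (intro Ck_on_compose[OF U open_graph_dom _ \<iota>_Ck[OF U]]) (auto simp: U_def smooth_on_def)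
  qed
  moreover have "bounded_linear Q" unfolding linear_conv_bounded_linear[symmetric] Q_def
    by (rule linearI) (auto simp: vec_eq_iff)
  moreover have "Q (P z) = z" for z by (simp add: Q_def P_def \<iota>_def graph_lift_def vec_eq_iff \<rho>\<tau> \<tau>k)
  moreover have "P ` U = slice_set t0 \<inter> {p. \<sigma> * snd p $ k > 0}"
  proof (intro equalityI subsetI)
    fix p assume "p \<in> P ` U"
    then obtain z where "p = graph_lift k \<sigma> (\<iota> z)" "\<iota> z \<in> graph_dom k" by (auto simp: P_def U_def)
    moreover from this have "p \<in> cylinder \<inter> {p. \<sigma> * snd p $ k > 0}" using graph_lift_image[OF \<sigma>(1)] by blast
    ultimately show "p \<in> slice_set t0 \<inter> {p. \<sigma> * snd p $ k > 0}"
      by (auto simp: slice_set_def cylinder_def graph_lift_def \<iota>_def)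
  next
    fix p assume p: "p \<in> slice_set t0 \<inter> {p. \<sigma> * snd p $ k > 0}"
    then have "p \<in> graph_lift k \<sigma> ` graph_dom k"
      unfolding graph_lift_image[OF \<sigma>(1)] by (simp add: slice_set_def cylinder_def)
    then obtain y where y: "y \<in> graph_dom k" "p = graph_lift k \<sigma> y" by blast
    have "y $ k = t0" using p by (simp add: slice_set_def y(2) graph_lift_def)
    then have "\<iota> (\<chi> a. y $ \<tau> a) = y" by (simp add: \<iota>_def vec_eq_iff \<tau>\<rho>)
    then show "p \<in> P ` U"
      using y by (intro image_eqI[of _ _ "\<chi> a. y $ \<tau> a"]) (simp_all add: P_def U_def)
  qed
  ultimately have "(slice_set t0 \<inter> {p. \<sigma> * snd p $ k > 0}, Q) \<in> atlas (lorentz_submanifold (slice_set t0))"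
    by (intro lift_chart_in_atlas[OF U _ _ _ open_half_space])
  then show ?thesis by (rule bexI[rotated]) (use assms \<sigma>(2) in simp)
qed

section \<open>Tangent spaces of the cylinder and of the slices\<close>

text \<open>Differentiate the equation of the cylinder along the chart. A subset \<open>S\<close> is
  allowed so that slices are covered as well.\<close>

lemma chart_on_cylinder:
  assumes d: "d \<in> atlas (lorentz_submanifold S)" and y: "y \<in> snd d ` fst d" and S: "S \<subseteq> cylinder"
  shows "snd (param d y) \<bullet> snd (frechet_derivative (param d) (at y) v) = 0"
proof -
  note D = atlas_lorentz_submanifoldD[OF d]
  let ?P = "param d" and ?D = "frechet_derivative (param d) (at y)"
  have "fst d \<subseteq> S" using openin_subset[OF D(1)] by simp
  then have "snd (?P z) \<bullet> snd (?P z) = 1" if "z \<in> snd d ` fst d" for z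
    using param_in[OF that] S by (auto simp: cylinder_def)
  moreover have "((\<lambda>z. snd (?P z) \<bullet> snd (?P z)) has_derivative
      (\<lambda>v. snd (?P y) \<bullet> snd (?D v) + snd (?D v) \<bullet> snd (?P y))) (at y)"
    using smooth_on_has_derivative[OF D(4,2) y] by (intro has_derivative_inner has_derivative_snd)
  ultimately have "((\<lambda>z. 1) has_derivative
      (\<lambda>v. snd (?P y) \<bullet> snd (?D v) + snd (?D v) \<bullet> snd (?P y))) (at y)"
    using has_derivative_transform_within_open[OF _ D(2) y] by (metis (no_types, lifting))
  then have "(\<lambda>v. snd (?P y) \<bullet> snd (?D v) + snd (?D v) \<bullet> snd (?P y)) = (\<lambda>v. 0)"
    using has_derivative_unique has_derivative_const by blast
  then have "snd (?P y) \<bullet> snd (?D v) + snd (?D v) \<bullet> snd (?P y) = 0" by meson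
  then show ?thesis by (simp add: inner_commute)
qed

lemma chart_on_slice:
  assumes d: "d \<in> atlas (lorentz_submanifold (slice_set t0))" and y: "y \<in> snd d ` fst d"
  shows "fst (frechet_derivative (param d) (at y) v) = 0"
proof -
  note D = atlas_lorentz_submanifoldD[OF d]
  let ?P = "param d" and ?D = "frechet_derivative (param d) (at y)"
  have "fst d \<subseteq> slice_set t0" using openin_subset[OF D(1)] by simp
  then have "fst (?P z) = t0" if "z \<in> snd d ` fst d" for z
    using param_in[OF that] by (auto simp: slice_set_def)
  moreover have "((\<lambda>z. fst (?P z)) has_derivative (\<lambda>v. fst (?D v))) (at y)"
    using smooth_on_has_derivative[OF D(4,2) y] by (intro has_derivative_fst)
  ultimately have "((\<lambda>z. t0) has_derivative (\<lambda>v. fst (?D v))) (at y)"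
    using has_derivative_transform_within_open[OF _ D(2) y] by (metis (no_types, lifting))
  then have "(\<lambda>v. fst (?D v)) = (\<lambda>v. 0)"
    using has_derivative_unique has_derivative_const by blast
  then show ?thesis by meson
qed

definition cylinder_tangent :: "real \<times> (real^'d) \<Rightarrow> (real \<times> (real^'d)) set" where
  "cylinder_tangent p = {w. snd p \<bullet> snd w = 0}"

definition slice_tangent :: "real \<times> (real^'d) \<Rightarrow> (real \<times> (real^'d)) set" where
  "slice_tangent p = {w. fst w = 0 \<and> snd p \<bullet> snd w = 0}"

text \<open>An injective linear map has an image of full dimension, so a dimension count replaces
  the construction of preimages.\<close>

lemma range_eq_subspaceI:
  fixes L :: "'a::euclidean_space \<Rightarrow> 'b::euclidean_space"
  assumes "linear L" "inj L" "subspace T" "range L \<subseteq> T" "dim T \<le> DIM('a)"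
  shows "range L = T"
proof (rule subspace_dim_equal)
  show "subspace (range L)" using assms(1) linear_subspace_image subspace_UNIV by blast
  have "dim (range L) = DIM('a)"
    using dim_image_eq[OF assms(1), of UNIV] assms(2) by (simp add: span_UNIV)
  then show "dim T \<le> dim (range L)" using assms(5) by simp
qed fact+

lemma map_to_cylinder:
  fixes M :: "('a, 'm::finite, 'y) manifold_scheme"
  assumes M: "smooth_manifold M"
  shows "map_to_submanifold M cylinder cylinder_tangent
    (static_einstein :: (real \<times> (real^'d::finite), 'd) semi_riemannian)"
proof
  show "range (frechet_derivative (param d) (at y)) = cylinder_tangent (param d y)"
    if "d \<in> atlas (static_einstein :: (real \<times> (real^'d), 'd) semi_riemannian)" "y \<in> snd d ` fst d"
    for d and y :: "real^'d"
  proof (rule range_eq_subspaceI)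
    note d = that(1)[unfolded static_einstein_eq]
    note D = atlas_lorentz_submanifoldD[OF d]
    let ?p = "param d y"
    \<comment> \<open>Written as a Euclidean hyperplane, so that the dimension formula for
      hyperplanes applies.\<close>
    have T: "cylinder_tangent ?p = {w. (0, snd ?p) \<bullet> w = 0}"
      by (simp add: cylinder_tangent_def inner_prod_def)
    show "subspace (cylinder_tangent ?p)" unfolding T by (rule subspace_hyperplane)
    have "?p \<in> cylinder" using param_in[OF that(2)] openin_subset[OF D(1)] by auto
    then have "(0 :: real, snd ?p) \<noteq> 0" by (auto simp: cylinder_def zero_prod_def)
    from dim_hyperplane[OF this] show "dim (cylinder_tangent ?p) \<le> DIM(real^'d)" unfolding T by simp
    show "linear (frechet_derivative (param d) (at y))"
      using smooth_on_has_derivative[OF D(4,2) that(2)] by (rule has_derivative_linear)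
    show "inj (frechet_derivative (param d) (at y))" by (rule D(5)[OF that(2)])
    show "range (frechet_derivative (param d) (at y)) \<subseteq> cylinder_tangent ?p"
      using chart_on_cylinder[OF d that(2) order_refl] by (auto simp: cylinder_tangent_def)
  qed
  show "v = 0" if "p \<in> cylinder" "v \<in> cylinder_tangent p" "\<And>w. w \<in> cylinder_tangent p \<Longrightarrow> lorentz v w = 0"
    for p v :: "real \<times> (real^'d)"
  proof -
    \<comment> \<open>Reflecting the time component of \<open>v\<close> keeps it tangent and turns
      the Lorentz product into the squared Euclidean norm of \<open>v\<close>.\<close>
    have "lorentz v (- fst v, snd v) = 0" using that(2,3) by (simp add: cylinder_tangent_def)
    then have "fst v * fst v + snd v \<bullet> snd v = 0" by (simp add: lorentz_def)
    then have "fst v = 0 \<and> snd v = 0"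
      by (metis add_nonneg_eq_0_iff inner_eq_zero_iff inner_ge_zero mult_eq_0_iff zero_le_square)
    then show "v = 0" by (simp add: prod_eq_iff)
  qed
qed (use M cylinder_atlas_covers in \<open>auto simp: static_einstein_eq\<close>)

lemma map_to_slice:
  fixes M :: "('a, 'm::finite, 'y) manifold_scheme"
  assumes dim: "CARD('d::finite) = CARD('n::finite) + 1" and M: "smooth_manifold M"
  shows "map_to_submanifold M (slice_set t0) slice_tangent
    (slice t0 :: (real \<times> (real^'d), 'n) semi_riemannian)"
proof
  show "range (frechet_derivative (param d) (at y)) = slice_tangent (param d y)"
    if "d \<in> atlas (slice t0 :: (real \<times> (real^'d), 'n) semi_riemannian)" "y \<in> snd d ` fst d"
    for d and y :: "real^'n"
  proof (rule range_eq_subspaceI)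
    note d = that(1)[unfolded slice_eq]
    note D = atlas_lorentz_submanifoldD[OF d]
    let ?p = "param d y" and ?\<iota> = "\<lambda>x :: real^'d. (0 :: real, x)"
    have lin: "linear ?\<iota>" by (rule linearI) auto
    have T: "slice_tangent ?p = ?\<iota> ` {w. snd ?p \<bullet> w = 0}"
      by (auto simp: slice_tangent_def)
    show "subspace (slice_tangent ?p)"
      unfolding T by (intro linear_subspace_image lin subspace_hyperplane)
    have p: "?p \<in> slice_set t0" using param_in[OF that(2)] openin_subset[OF D(1)] by auto
    then have "snd ?p \<noteq> 0" by (auto simp: slice_set_def)
    then have "dim {w. snd ?p \<bullet> w = 0} = CARD('n)" using dim by (simp add: dim_hyperplane)
    moreover have "dim (slice_tangent ?p) \<le> dim {w. snd ?p \<bullet> w = 0}"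
      unfolding T by (rule dim_image_le[OF lin])
    ultimately show "dim (slice_tangent ?p) \<le> DIM(real^'n)" by simp
    show "linear (frechet_derivative (param d) (at y))"
      using smooth_on_has_derivative[OF D(4,2) that(2)] by (rule has_derivative_linear)
    show "inj (frechet_derivative (param d) (at y))" by (rule D(5)[OF that(2)])
    have "slice_set t0 \<subseteq> (cylinder :: (real \<times> (real^'d)) set)" by (auto simp: slice_set_def cylinder_def)
    then show "range (frechet_derivative (param d) (at y)) \<subseteq> slice_tangent ?p"
      using chart_on_cylinder[OF d that(2)] chart_on_slice[OF d that(2)] by (auto simp: slice_tangent_def)
  qed
  \<comment> \<open>Vectors tangent to a slice have no time component, so the product is Euclidean
    and \<open>v\<close> can be tested with itself.\<close>
  show "v = 0" if "p \<in> slice_set t0" "v \<in> slice_tangent p" "\<And>w. w \<in> slice_tangent p \<Longrightarrow> lorentz v w = 0"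
    for p v :: "real \<times> (real^'d)"
    using that(2) that(3)[OF that(2)] by (simp add: slice_tangent_def lorentz_def prod_eq_iff)
qed (use M slice_atlas_covers[OF dim] in \<open>auto simp: slice_eq\<close>)

section \<open>Second-order conditions at a maximum, and positive definite matrices\<close>

text \<open>Restriction to the line through \<open>x\<close> in direction \<open>e\<close> leaves
  one variable. A positive second derivative would make the first one positive just after 0, and by
  the mean value theorem \<open>w\<close> would exceed its value at \<open>x\<close>.\<close>

lemma second_order_max:
  fixes w :: "'e::real_normed_vector \<Rightarrow> real"
  assumes "r > 0" and D: "\<And>y. y \<in> ball x r \<Longrightarrow> (w has_derivative D y) (at y)"
    and D2: "((\<lambda>y. D y e) has_derivative D2) (at x)"
    and max: "\<And>y. y \<in> ball x r \<Longrightarrow> w y \<le> w x"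
  shows "D x e = 0" "D2 e \<le> 0"
proof -
  define q where "q = r / (norm e + 1)"
  have q: "q > 0" unfolding q_def using assms(1) by (intro divide_pos_pos) (simp_all add: add_nonneg_pos)
  have in_ball: "x + s *\<^sub>R e \<in> ball x r" if "\<bar>s\<bar> < q" for s
  proof -
    have "\<bar>s\<bar> * norm e \<le> \<bar>s\<bar> * (norm e + 1)" by (intro mult_left_mono) auto
    also have "\<dots> < q * (norm e + 1)" using that by (intro mult_strict_right_mono) (simp_all add: add_nonneg_pos)
    also have "\<dots> = r" unfolding q_def using norm_ge_zero[of e] by (simp add: add_nonneg_pos less_imp_neq[symmetric])
    finally show ?thesis by (simp add: dist_norm)
  qed
  have line: "((\<lambda>s. x + s *\<^sub>R e) has_derivative (\<lambda>u. u *\<^sub>R e)) (at s)" for s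
    by (auto intro!: derivative_eq_intros)
  have d1: "((\<lambda>s. w (x + s *\<^sub>R e)) has_real_derivative D (x + s *\<^sub>R e) e) (at s)" if "\<bar>s\<bar> < q" for s
    using has_derivative_compose[OF line D[OF in_ball[OF that]]]
    by (rule has_derivative_imp_has_field_derivative)
      (simp add: linear_cmul[OF has_derivative_linear[OF D[OF in_ball[OF that]]]])
  have "((\<lambda>y. D y e) has_derivative D2) (at (x + 0 *\<^sub>R e))" using D2 by simp
  from has_derivative_compose[OF line this]
  have d2: "((\<lambda>s. D (x + s *\<^sub>R e) e) has_real_derivative D2 e) (at 0)"
    by (rule has_derivative_imp_has_field_derivative) (simp add: linear_cmul[OF has_derivative_linear[OF D2]])
  have "D (x + 0 *\<^sub>R e) e = 0"
    by (rule DERIV_local_max[OF d1 q]) (use q max in_ball in \<open>auto simp: abs_minus_commute\<close>)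
  then show D0: "D x e = 0" by simp
  show "D2 e \<le> 0"
  proof (rule ccontr)
    assume "\<not> D2 e \<le> 0"
    then obtain d where d: "d > 0" "\<And>h. h > 0 \<Longrightarrow> h < d \<Longrightarrow> D (x + 0 *\<^sub>R e) e < D (x + (0 + h) *\<^sub>R e) e"
      using DERIV_pos_inc_right[OF d2] by auto
    define s where "s = min d q / 2"
    have s: "0 < s" "s < d" "s < q" using d q by (auto simp: s_def min_def)
    have "\<exists>z>0. z < s \<and> w (x + s *\<^sub>R e) - w (x + 0 *\<^sub>R e) = (s - 0) * D (x + z *\<^sub>R e) e"
      by (rule MVT2[OF s(1) d1]) (use s in auto)
    then obtain z where z: "0 < z" "z < s" "w (x + s *\<^sub>R e) - w x = s * D (x + z *\<^sub>R e) e" by auto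
    have "D (x + z *\<^sub>R e) e > 0" using d(2)[of z] z s D0 by simp
    then have "w (x + s *\<^sub>R e) > w x" using z(3) s(1) by (smt (verit) mult_pos_pos)
    then show False using max[OF in_ball[of s]] s by simp
  qed
qed

text \<open>Gram-Schmidt for the inner product given by \<open>g\<close>, by induction on the index
  set. A new direction exists because fewer than \<open>CARD('m)\<close> vectors cannot span the
  space.\<close>

lemma orthonormal_family:
  fixes g :: "real^'m^'m::finite" and J :: "'m set"
  assumes sym: "transpose g = g" and pos: "\<And>v. v \<noteq> 0 \<Longrightarrow> v \<bullet> (g *v v) > 0"
  shows "\<exists>e. \<forall>i\<in>J. \<forall>j\<in>J. e i \<bullet> (g *v e j) = (if i = j then 1 else 0)"
proof (induction J rule: finite_induct[OF finite])
  case (2 k J)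
  have comm: "a \<bullet> (g *v b) = b \<bullet> (g *v a)" for a b
    by (metis dot_lmul_matrix inner_commute sym transpose_matrix_vector)
  obtain e :: "'m \<Rightarrow> real^'m" where e: "\<And>i j. i \<in> J \<Longrightarrow> j \<in> J \<Longrightarrow> e i \<bullet> (g *v e j) = (if i = j then 1 else 0)"
    using 2 by blast
  have "dim (span (e ` J)) \<le> card J"
    using dim_le_card'[of "e ` J"] card_image_le[of J e] by (simp add: order_trans)
  also have "\<dots> < CARD('m)" using 2(2) by (intro psubset_card_mono) auto
  finally have dim_lt: "dim (span (e ` J)) < CARD('m)" .
  have "span (e ` J) \<noteq> UNIV"
  proof
    assume "span (e ` J) = UNIV"
    with dim_lt have "dim (UNIV :: (real^'m) set) < CARD('m)" by (simp only:)
    then show False by simp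
  qed
  then obtain v where v: "v \<notin> span (e ` J)" by blast
  define u where "u = v - (\<Sum>j\<in>J. (v \<bullet> (g *v e j)) *\<^sub>R e j)"
  have "(\<Sum>j\<in>J. (v \<bullet> (g *v e j)) *\<^sub>R e j) \<in> span (e ` J)"
    by (intro span_sum span_scale span_base) auto
  then have "u \<noteq> 0" using v by (auto simp: u_def)
  have orth: "u \<bullet> (g *v e i) = 0" if "i \<in> J" for i
  proof -
    have "(\<Sum>j\<in>J. (v \<bullet> (g *v e j)) * (e j \<bullet> (g *v e i))) = (\<Sum>j\<in>J. if j = i then v \<bullet> (g *v e j) else 0)"
      by (rule sum.cong) (auto simp: e that)
    then show ?thesis using that by (simp add: u_def inner_diff_left inner_sum_left)
  qed
  define n where "n = sqrt (u \<bullet> (g *v u))"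
  have n: "n * n = u \<bullet> (g *v u)" "n > 0" using pos[OF \<open>u \<noteq> 0\<close>] by (simp_all add: n_def)
  define f where "f = e(k := (1 / n) *\<^sub>R u)"
  have fk: "f k = (1 / n) *\<^sub>R u" and fi: "i \<in> J \<Longrightarrow> f i = e i" for i
    using 2(2) by (auto simp: f_def)
  have kk: "f k \<bullet> (g *v f k) = 1"
    using n by (simp add: fk matrix_vector_mult_scaleR n(1)[symmetric])
  have ik: "f i \<bullet> (g *v f k) = 0" "f k \<bullet> (g *v f i) = 0" if "i \<in> J" for i
    using orth[OF that] comm[of "f i" "f k"] that by (simp_all add: fk fi)
  have "f i \<bullet> (g *v f j) = (if i = j then 1 else 0)" if "i \<in> insert k J" "j \<in> insert k J" for i j
    using that kk ik e fi 2(2) by (cases "i = k"; cases "j = k") auto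
  then show ?case by blast
qed simp

text \<open>Take a \<open>g\<close>-orthonormal basis as the columns of \<open>E\<close>: then E^T g
  E is the identity, and one-sided inverses of square matrices are two-sided.\<close>

lemma matrix_inv_eq_mult_transpose:
  fixes g :: "real^'m^'m::finite"
  assumes "transpose g = g" "\<And>v. v \<noteq> 0 \<Longrightarrow> v \<bullet> (g *v v) > 0"
  obtains E :: "real^'m^'m" where "matrix_inv g = E ** transpose E"
proof -
  obtain e :: "'m \<Rightarrow> real^'m" where e: "\<And>i j. e i \<bullet> (g *v e j) = (if i = j then 1 else 0)"
    using orthonormal_family[OF assms, of UNIV] by blast
  define E :: "real^'m^'m" where "E = (\<chi> i j. e j $ i)"
  have col: "column j E = e j" for j by (simp add: E_def column_def vec_eq_iff)
  have "(transpose E ** (g ** E)) $ i $ j = e i \<bullet> (g *v e j)" for i j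
    by (simp add: matrix_matrix_mult_def transpose_def E_def inner_vec_def matrix_vector_mult_def)
  then have "transpose E ** (g ** E) = mat 1" by (simp add: vec_eq_iff e mat_def)
  then have "(transpose E ** g) ** E = mat 1" by (simp add: matrix_mul_assoc)
  then have "E ** (transpose E ** g) = mat 1" by (simp add: matrix_left_right_inverse)
  then have left: "(E ** transpose E) ** g = mat 1" by (simp add: matrix_mul_assoc)
  then have "det g \<noteq> 0"
    unfolding invertible_det_nz[symmetric] invertible_left_inverse by blast
  note right = matrix_mult_matrix_inv[OF this]
  have "matrix_inv g = ((E ** transpose E) ** g) ** matrix_inv g" by (simp add: left)
  also have "\<dots> = (E ** transpose E) ** (g ** matrix_inv g)" by (simp add: matrix_mul_assoc)
  also have "\<dots> = E ** transpose E" by (simp add: right)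
  finally show ?thesis by (rule that)
qed

text \<open>The double sum splits into the values of the quadratic form of \<open>H\<close> at the
  columns of \<open>E\<close>.\<close>

lemma trace_mult_nonpos:
  fixes E :: "real^'m^'m::finite"
  assumes "\<And>v. (\<Sum>i\<in>UNIV. \<Sum>j\<in>UNIV. v $ i * v $ j * H i j) \<le> (0 :: real)"
  shows "(\<Sum>i\<in>UNIV. \<Sum>j\<in>UNIV. (E ** transpose E) $ i $ j * H i j) \<le> 0"
proof -
  have "(\<Sum>i\<in>UNIV. \<Sum>j\<in>UNIV. (E ** transpose E) $ i $ j * H i j)
      = (\<Sum>i\<in>UNIV. \<Sum>j\<in>UNIV. \<Sum>k\<in>UNIV. column k E $ i * column k E $ j * H i j)"
    by (simp add: matrix_matrix_mult_def transpose_def column_def sum_distrib_right)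
  also have "\<dots> = (\<Sum>i\<in>UNIV. \<Sum>k\<in>UNIV. \<Sum>j\<in>UNIV. column k E $ i * column k E $ j * H i j)"
    by (intro sum.cong refl sum.swap)
  also have "\<dots> = (\<Sum>k\<in>UNIV. \<Sum>i\<in>UNIV. \<Sum>j\<in>UNIV. column k E $ i * column k E $ j * H i j)"
    by (rule sum.swap)
  also have "\<dots> \<le> 0" by (intro sum_nonpos assms)
  finally show ?thesis .
qed

section \<open>The strong maximum principle\<close>

text \<open>The leading coefficients are given as an inverse matrix because \<open>g\<close> will be
  the first fundamental form and \<open>f\<close> the time. The bound \<open>m\<close> need not be
  attained.\<close>

locale elliptic_solution =
  fixes V :: "(real^'m::finite) set" and g :: "real^'m \<Rightarrow> real^'m^'m" and b :: "real^'m \<Rightarrow> real^'m"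
    and f :: "real^'m \<Rightarrow> real" and m :: real
  assumes V: "open V"
    and cont_A: "continuous_on V (\<lambda>x. matrix_inv (g x) $ i $ j)"
    and cont_b: "continuous_on V (\<lambda>x. b x $ i)"
    and sym: "x \<in> V \<Longrightarrow> transpose (g x) = g x"
    and pos: "x \<in> V \<Longrightarrow> v \<noteq> 0 \<Longrightarrow> v \<bullet> (g x *v v) > 0"
    and smooth: "smooth_on V f"
    and solution: "x \<in> V \<Longrightarrow> (\<Sum>i\<in>UNIV. \<Sum>j\<in>UNIV. matrix_inv (g x) $ i $ j * partial i (partial j f) x)
      + (\<Sum>k\<in>UNIV. b x $ k * partial k f x) = 0"
    and le: "x \<in> V \<Longrightarrow> f x \<le> m"
begin

abbreviation "A x \<equiv> matrix_inv (g x)"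

text \<open>For h(y) = exp(-\<alpha> |y - z|^2) and \<xi> = y - z the operator yields 2 \<alpha> h
  (2 \<alpha> \<open>quad\<close> - \<open>drift\<close>); the two definitions are the coefficients
  of this computation.\<close>

definition quad :: "real^'m \<Rightarrow> real^'m \<Rightarrow> real" where
  "quad x \<xi> = (\<Sum>i\<in>UNIV. \<Sum>j\<in>UNIV. A x $ i $ j * (\<xi> $ i * \<xi> $ j))"

definition drift :: "real^'m \<Rightarrow> real^'m \<Rightarrow> real" where
  "drift x \<xi> = (\<Sum>i\<in>UNIV. A x $ i $ i) + (\<Sum>k\<in>UNIV. b x $ k * \<xi> $ k)"

text \<open>With \<eta> = g^-1 \<xi> the form takes the value \<eta> \<bullet> g \<eta>.\<close>

lemma quad_pos:
  assumes "x \<in> V" "\<xi> \<noteq> 0"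
  shows "quad x \<xi> > 0"
proof -
  have "v = 0" if "g x *v v = 0" for v using pos[OF assms(1), of v] that by auto
  then have "det (g x) \<noteq> 0"
    by (simp add: invertible_det_nz[symmetric] invertible_left_inverse matrix_left_invertible_ker)
  from matrix_mult_matrix_inv[OF this] have eq: "g x *v (A x *v \<xi>) = \<xi>"
    by (simp add: matrix_vector_mul_assoc)
  then have "A x *v \<xi> \<noteq> 0" using assms(2) by auto
  from pos[OF assms(1) this] have "(A x *v \<xi>) \<bullet> \<xi> > 0" by (simp add: eq)
  moreover have "(A x *v \<xi>) \<bullet> \<xi> = quad x \<xi>"
    by (simp add: quad_def inner_vec_def matrix_vector_mult_def sum_distrib_left sum_distrib_right mult_ac)
  ultimately show ?thesis by simp
qed

text \<open>The condition on \<alpha> makes the operator strictly positive on the perturbed function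
  at \<open>x\<close>. At an interior maximum, however, the gradient vanishes and the trace of the
  Hessian against the inverse of \<open>g\<close> is nonpositive.\<close>

lemma no_interior_max:
  assumes r: "r > 0" "ball x r \<subseteq> V" and \<epsilon>: "\<epsilon> > 0" and \<alpha>: "\<alpha> > 0" "2 * \<alpha> * quad x (x - z) > drift x (x - z)"
    and max: "\<And>y. y \<in> ball x r \<Longrightarrow> f y + \<epsilon> * exp (- \<alpha> * ((y - z) \<bullet> (y - z))) \<le> f x + \<epsilon> * exp (- \<alpha> * ((x - z) \<bullet> (x - z)))"
  shows False
proof -
  define h where "h y = \<epsilon> * exp (- \<alpha> * ((y - z) \<bullet> (y - z)))" for y
  \<comment> \<open>\<open>D\<close> is the derivative of \<open>f + h\<close>, and \<open>H\<close>
    below is its Hessian at \<open>x\<close>.\<close>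
  define D where "D y e = frechet_derivative f (at y) e - 2 * \<alpha> * h y * ((y - z) \<bullet> e)" for y e
  define H where "H i j = partial i (partial j f) x +
    h x * (4 * \<alpha>\<^sup>2 * ((x - z) $ i * (x - z) $ j) - 2 * \<alpha> * (if i = j then 1 else 0))" for i j
  have x: "x \<in> V" using r by auto
  have h: "(h has_derivative (\<lambda>e. - 2 * \<alpha> * h y * ((y - z) \<bullet> e))) (at y)" for y
    unfolding h_def by (auto intro!: derivative_eq_intros simp: inner_commute algebra_simps)
  have w: "((\<lambda>y. f y + h y) has_derivative D y) (at y)" if "y \<in> V" for y
    unfolding D_def using has_derivative_add[OF smooth_on_has_derivative[OF smooth V that] h] by simp
  have expand: "frechet_derivative f (at y) e = (\<Sum>j\<in>UNIV. e $ j *\<^sub>R partial j f y)" if "y \<in> V" for y e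
    unfolding partial_def
    using smooth_on_has_derivative[OF smooth V that] by (intro linear_axis_expansion has_derivative_linear)
  note D2f = smooth_on_has_derivative[OF smooth_on_partial[OF smooth] V x]
  have D2: "((\<lambda>y. D y e) has_derivative (\<lambda>v. (\<Sum>j\<in>UNIV. e $ j *\<^sub>R frechet_derivative (partial j f) (at x) v)
      - 2 * \<alpha> * (h x * (v \<bullet> e) + (- 2 * \<alpha> * h x * ((x - z) \<bullet> v)) * ((x - z) \<bullet> e)))) (at x)" for e
  proof -
    have "((\<lambda>y. (\<Sum>j\<in>UNIV. e $ j *\<^sub>R partial j f y) - 2 * \<alpha> * (h y * ((y - z) \<bullet> e))) has_derivative
      (\<lambda>v. (\<Sum>j\<in>UNIV. e $ j *\<^sub>R frechet_derivative (partial j f) (at x) v)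
      - 2 * \<alpha> * (h x * (v \<bullet> e) + (- 2 * \<alpha> * h x * ((x - z) \<bullet> v)) * ((x - z) \<bullet> e)))) (at x)"
      by (intro has_derivative_diff has_derivative_sum has_derivative_scaleR_right D2f has_derivative_mult_right
          has_derivative_mult h has_derivative_inner_left) (auto intro!: derivative_eq_intros)
    then show ?thesis
      by (rule has_derivative_transform_within_open[OF _ V x]) (simp add: D_def expand mult_ac)
  qed
  have max': "f y + h y \<le> f x + h x" if "y \<in> ball x r" for y using max[OF that] by (simp add: h_def)
  have wD: "((\<lambda>y. f y + h y) has_derivative D y) (at y)" if "y \<in> ball x r" for y
    using w that r(2) by blast
  note so = second_order_max[OF r(1) wD D2 max']
  \<comment> \<open>The gradient of \<open>f + h\<close> vanishes at \<open>x\<close>; this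
    expresses the first-order terms in the equation for \<open>f\<close> through
    \<open>h\<close>.\<close>
  have grad: "partial k f x = 2 * \<alpha> * h x * (x - z) $ k" for k
    using so(1)[of "axis k 1"] by (simp add: D_def partial_def inner_axis)
  have quad_form: "(\<Sum>i\<in>UNIV. \<Sum>j\<in>UNIV. v $ i * v $ j * H i j) \<le> 0" for v
  proof -
    have exp2: "frechet_derivative (partial j f) (at x) v = (\<Sum>i\<in>UNIV. v $ i *\<^sub>R partial i (partial j f) x)" for j
      unfolding partial_def[of _ "partial j f"] using D2f by (intro linear_axis_expansion has_derivative_linear)
    have 1: "(\<Sum>i\<in>UNIV. \<Sum>j\<in>UNIV. v $ i * v $ j * partial i (partial j f) x) =
        (\<Sum>j\<in>UNIV. v $ j *\<^sub>R frechet_derivative (partial j f) (at x) v)"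
      by (subst sum.swap) (simp add: exp2 sum_distrib_left mult_ac)
    have 2: "(\<Sum>i\<in>UNIV. \<Sum>j\<in>UNIV. v $ i * v $ j * ((x - z) $ i * (x - z) $ j)) = ((x - z) \<bullet> v) * ((x - z) \<bullet> v)"
      by (simp add: inner_vec_def sum_product mult_ac)
    have 3: "(\<Sum>i\<in>UNIV. \<Sum>j\<in>UNIV. v $ i * v $ j * (if i = j then 1 else 0)) = v \<bullet> v"
      by (simp add: inner_vec_def if_distrib cong: if_cong)
    have "v $ i * v $ j * H i j = v $ i * v $ j * partial i (partial j f) x
       + 4 * \<alpha>\<^sup>2 * h x * (v $ i * v $ j * ((x - z) $ i * (x - z) $ j))
       - 2 * \<alpha> * h x * (v $ i * v $ j * (if i = j then 1 else 0))" for i j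
      by (simp add: H_def algebra_simps)
    then have "(\<Sum>i\<in>UNIV. \<Sum>j\<in>UNIV. v $ i * v $ j * H i j) =
        (\<Sum>j\<in>UNIV. v $ j *\<^sub>R frechet_derivative (partial j f) (at x) v)
        + 4 * \<alpha>\<^sup>2 * h x * (((x - z) \<bullet> v) * ((x - z) \<bullet> v)) - 2 * \<alpha> * h x * (v \<bullet> v)"
      by (simp only: sum.distrib sum_subtractf sum_distrib_left[symmetric] 1 2 3)
    also have "\<dots> \<le> 0" using so(2)[of v] by (simp add: algebra_simps power2_eq_square)
    finally show ?thesis .
  qed
  obtain E :: "real^'m^'m" where "A x = E ** transpose E"
    by (rule matrix_inv_eq_mult_transpose[OF sym[OF x] pos[OF x]])
  then have "(\<Sum>i\<in>UNIV. \<Sum>j\<in>UNIV. A x $ i $ j * H i j) \<le> 0"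
    using trace_mult_nonpos[OF quad_form] by simp
  moreover have "(\<Sum>i\<in>UNIV. \<Sum>j\<in>UNIV. A x $ i $ j * H i j) =
      (\<Sum>i\<in>UNIV. \<Sum>j\<in>UNIV. A x $ i $ j * partial i (partial j f) x)
      + 4 * \<alpha>\<^sup>2 * h x * quad x (x - z) - 2 * \<alpha> * h x * (\<Sum>i\<in>UNIV. A x $ i $ i)"
  proof -
    have 3: "(\<Sum>i\<in>UNIV. \<Sum>j\<in>UNIV. A x $ i $ j * (if i = j then 1 else 0)) = (\<Sum>i\<in>UNIV. A x $ i $ i)"
      by (simp add: if_distrib cong: if_cong)
    have "A x $ i $ j * H i j = A x $ i $ j * partial i (partial j f) x
       + 4 * \<alpha>\<^sup>2 * h x * (A x $ i $ j * ((x - z) $ i * (x - z) $ j))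
       - 2 * \<alpha> * h x * (A x $ i $ j * (if i = j then 1 else 0))" for i j
      by (simp add: H_def algebra_simps)
    then show ?thesis
      by (simp only: sum.distrib sum_subtractf sum_distrib_left[symmetric] 3 quad_def)
  qed
  moreover have "(\<Sum>i\<in>UNIV. \<Sum>j\<in>UNIV. A x $ i $ j * partial i (partial j f) x) =
      - 2 * \<alpha> * h x * (\<Sum>k\<in>UNIV. b x $ k * (x - z) $ k)"
  proof -
    have "(\<Sum>k\<in>UNIV. b x $ k * partial k f x) = 2 * \<alpha> * h x * (\<Sum>k\<in>UNIV. b x $ k * (x - z) $ k)"
      unfolding grad sum_distrib_left by (rule sum.cong) (simp_all only: mult_ac)
    then show ?thesis using solution[OF x] by simp
  qed
  ultimately have "2 * \<alpha> * h x * (2 * \<alpha> * quad x (x - z) - drift x (x - z)) \<le> 0"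
    by (simp add: drift_def algebra_simps power2_eq_square)
  moreover have "2 * \<alpha> * h x > 0" using \<alpha>(1) \<epsilon> by (simp add: h_def)
  ultimately have "2 * \<alpha> * quad x (x - z) - drift x (x - z) \<le> 0"
    using mult_pos_pos[of "2 * \<alpha> * h x" "2 * \<alpha> * quad x (x - z) - drift x (x - z)"] by linarith
  then show False using \<alpha>(2) by simp
qed

text \<open>The touching ball carries a barrier that vanishes at \<open>x1\<close>. The perturbed
  function still reaches \<open>m\<close> at \<open>x1\<close> but stays below \<open>m\<close> on a
  small sphere around it, against \<open>no_interior_max\<close>.\<close>

lemma hopf_touching_ball:
  assumes "x1 \<in> V" "f x1 = m" "z \<noteq> x1"
    and lt: "\<And>y. y \<in> cball z (dist z x1) \<Longrightarrow> y \<noteq> x1 \<Longrightarrow> y \<in> V \<and> f y < m"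
  shows False
proof -
  define R where "R = dist z x1"
  have R: "R > 0" using assms(3) by (simp add: R_def)
  obtain r0 where r0: "r0 > 0" "cball x1 r0 \<subseteq> V" using V assms(1) open_contains_cball by blast
  \<comment> \<open>A radius below \<open>R\<close> keeps \<open>z\<close> out of the small ball, so
    \<open>quad y (y - z)\<close> has a positive minimum there.\<close>
  define r where "r = min r0 (R / 2)"
  have r: "r > 0" "r < R" "cball x1 r \<subseteq> V" using r0 R by (auto simp: r_def)
  have far: "y - z \<noteq> 0" if "y \<in> cball x1 r" for y
    using that r(2) by (auto simp: R_def dist_commute)
  have cA: "continuous_on (cball x1 r) (\<lambda>x. A x $ i $ j)" for i j by (rule continuous_on_subset[OF cont_A r(3)])
  have cb: "continuous_on (cball x1 r) (\<lambda>x. b x $ i)" for i by (rule continuous_on_subset[OF cont_b r(3)])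
  have ne: "cball x1 r \<noteq> {}" using r(1) by simp
  have "continuous_on (cball x1 r) (\<lambda>y. quad y (y - z))"
    unfolding quad_def by (intro continuous_intros cA)
  then obtain y0 where y0: "y0 \<in> cball x1 r" "\<And>y. y \<in> cball x1 r \<Longrightarrow> quad y0 (y0 - z) \<le> quad y (y - z)"
    using continuous_attains_inf[OF compact_cball ne] by blast
  define l where "l = quad y0 (y0 - z)"
  have l: "l > 0" unfolding l_def using y0(1) r(3) far by (intro quad_pos) auto
  have "continuous_on (cball x1 r) (\<lambda>y. drift y (y - z))"
    unfolding drift_def by (intro continuous_intros cA cb)
  then obtain y1 where y1: "y1 \<in> cball x1 r" "\<And>y. y \<in> cball x1 r \<Longrightarrow> drift y (y - z) \<le> drift y1 (y1 - z)"
    using continuous_attains_sup[OF compact_cball ne] by blast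
  \<comment> \<open>\<open>l\<close> is the minimum of \<open>quad\<close> and \<open>y1\<close>
    maximizes \<open>drift\<close> on the small ball; the summand 1 makes 2 \<alpha> l strictly
    larger than every drift and \<alpha> positive.\<close>
  define \<alpha> where "\<alpha> = (\<bar>drift y1 (y1 - z)\<bar> + 1) / (2 * l)"
  have \<alpha>: "\<alpha> > 0" unfolding \<alpha>_def using l by (intro divide_pos_pos) auto
  have \<alpha>2: "2 * \<alpha> * quad y (y - z) > drift y (y - z)" if "y \<in> cball x1 r" for y
  proof -
    have "drift y (y - z) \<le> \<bar>drift y1 (y1 - z)\<bar>" using y1(2)[OF that] by linarith
    also have "\<dots> < 2 * \<alpha> * l" using l by (simp add: \<alpha>_def)
    also have "\<dots> \<le> 2 * \<alpha> * quad y (y - z)" using \<alpha> y0(2)[OF that] by (simp add: l_def)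
    finally show ?thesis .
  qed
  \<comment> \<open>On the sphere around \<open>x1\<close>, \<open>f < m\<close> inside the touching ball and \<open>v < 0\<close> outside it, so for
    small \<open>\<epsilon>\<close> the perturbation \<open>f + \<epsilon> v\<close> has an interior maximum, where the equation fails.\<close>
  define v where "v y = exp (- \<alpha> * ((y - z) \<bullet> (y - z))) - exp (- \<alpha> * (R * R))" for y
  have v_neg: "v y < 0" if "dist z y > R" for y
  proof -
    have "R * R < (y - z) \<bullet> (y - z)"
    proof -
      have "R < norm (y - z)" using that by (simp add: dist_norm norm_minus_commute)
      then have "R * R < norm (y - z) * norm (y - z)" using R by (intro mult_strict_mono) auto
      then show ?thesis by (simp add: dot_square_norm power2_eq_square)
    qed
    then show ?thesis using \<alpha> by (simp add: v_def)
  qed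
  have v_le: "v y < 1" for y
  proof -
    have "exp (- \<alpha> * ((y - z) \<bullet> (y - z))) \<le> 1" using \<alpha> by (simp add: mult_nonneg_nonneg)
    then show ?thesis unfolding v_def using exp_gt_zero[of "- \<alpha> * (R * R)"] by linarith
  qed
  have v_x1: "v x1 = 0"
    by (simp add: v_def R_def dist_norm norm_minus_commute dot_square_norm power2_eq_square)
  have cont_f: "continuous_on (cball x1 r) f"
    using smooth r(3) unfolding smooth_on_def by (metis Ck_on.simps(1) continuous_on_subset)
  \<comment> \<open>On the part of the small sphere inside the touching ball, which avoids
    \<open>x1\<close>, compactness gives a uniform gap below \<open>m\<close>.\<close>
  obtain \<delta> where \<delta>: "\<delta> > 0" "\<And>y. y \<in> sphere x1 r \<inter> cball z R \<Longrightarrow> f y \<le> m - \<delta>"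
  proof (cases "sphere x1 r \<inter> cball z R = {}")
    case True
    then show ?thesis using that[of 1] by auto
  next
    case False
    have "compact (sphere x1 r \<inter> cball z R)" by (intro compact_Int_closed) auto
    moreover have "continuous_on (sphere x1 r \<inter> cball z R) f"
      by (rule continuous_on_subset[OF cont_f]) auto
    ultimately obtain y2 where y2: "y2 \<in> sphere x1 r \<inter> cball z R"
        "\<And>y. y \<in> sphere x1 r \<inter> cball z R \<Longrightarrow> f y \<le> f y2"
      using continuous_attains_sup[OF _ False] by blast
    have "f y2 < m" using lt[of y2] y2(1) r(1) by (auto simp: R_def)
    then show ?thesis using that[of "m - f y2"] y2(2) by auto
  qed
  \<comment> \<open>As \<open>v < 1\<close>, a perturbation with a factor below \<delta> cannot
    close the gap.\<close>
  define \<epsilon> where "\<epsilon> = \<delta> / 2"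
  have \<epsilon>: "\<epsilon> > 0" using \<delta>(1) by (simp add: \<epsilon>_def)
  have bdry: "f y + \<epsilon> * v y < m" if "y \<in> sphere x1 r" for y
  proof (cases "dist z y > R")
    case True
    have "f y \<le> m" using that r(3) by (intro le) auto
    then show ?thesis using mult_pos_neg[OF \<epsilon> v_neg[OF True]] by simp
  next
    case False
    then have "f y \<le> m - \<delta>" using that by (intro \<delta>(2)) auto
    moreover have "\<epsilon> * v y \<le> \<epsilon>" using v_le[of y] \<epsilon> by (simp add: mult_left_le)
    moreover have "\<epsilon> < \<delta>" using \<delta>(1) by (simp add: \<epsilon>_def)
    ultimately show ?thesis by linarith
  qed
  have "continuous_on (cball x1 r) (\<lambda>y. f y + \<epsilon> * v y)"
    unfolding v_def by (intro continuous_intros cont_f)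
  then obtain x where x: "x \<in> cball x1 r" "\<And>y. y \<in> cball x1 r \<Longrightarrow> f y + \<epsilon> * v y \<le> f x + \<epsilon> * v x"
    using continuous_attains_sup[OF compact_cball ne] by blast
  \<comment> \<open>The barrier vanishes at \<open>x1\<close>, so the maximum is at least
    \<open>m\<close> and cannot lie on the sphere.\<close>
  have "f x + \<epsilon> * v x \<ge> m" using x(2)[of x1] assms(2) v_x1 r(1) by simp
  then have "x \<notin> sphere x1 r" using bdry by force
  then have "x \<in> ball x1 r" using x(1) by auto
  then obtain s where s: "s > 0" "ball x s \<subseteq> ball x1 r" using openE open_ball by blast
  show False
  proof (rule no_interior_max[OF s(1) _ \<epsilon> \<alpha> \<alpha>2[OF x(1)]])
    show "ball x s \<subseteq> V" using s(2) r(3) ball_subset_cball by blast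
    show "f y + \<epsilon> * exp (- \<alpha> * ((y - z) \<bullet> (y - z))) \<le> f x + \<epsilon> * exp (- \<alpha> * ((x - z) \<bullet> (x - z)))"
      if "y \<in> ball x s" for y
    proof -
      have "y \<in> cball x1 r" using that s(2) ball_subset_cball by blast
      from x(2)[OF this] show ?thesis by (simp add: v_def algebra_simps)
    qed
  qed
qed

text \<open>If \<open>f z\<close> differed from \<open>m\<close>, the point of the maximum set
  nearest to \<open>z\<close> would be a contact point for \<open>hopf_touching_ball\<close>. Its
  distance from \<open>z\<close> is at most that of \<open>x0\<close>, so the radius \<rho> / 2
  keeps the touching ball inside \<open>V\<close>.\<close>

lemma constant_near_max:
  assumes "cball x0 \<rho> \<subseteq> V" "\<rho> > 0" "f x0 = m" and z: "z \<in> ball x0 (\<rho> / 2)"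
  shows "f z = m"
proof (rule ccontr)
  assume "f z \<noteq> m"
  define C where "C = {x \<in> cball x0 \<rho>. f x = m}"
  have cont: "continuous_on (cball x0 \<rho>) f"
    using smooth assms(1) unfolding smooth_on_def by (metis Ck_on.simps(1) continuous_on_subset)
  have "closed C"
    unfolding C_def by (rule continuous_closed_preimage_constant[OF cont closed_cball])
  moreover have "x0 \<in> C" using assms(2,3) by (simp add: C_def)
  ultimately obtain x1 where x1: "x1 \<in> C" "\<And>y. y \<in> C \<Longrightarrow> dist z x1 \<le> dist z y"
    using distance_attains_inf by (metis empty_iff)
  define R where "R = dist z x1"
  have "R \<le> dist z x0" using x1(2)[OF \<open>x0 \<in> C\<close>] by (simp add: R_def)
  then have R2: "R < \<rho> / 2" using z by (simp add: dist_commute)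
  \<comment> \<open>The ball of half the radius around \<open>c\<close> meets \<open>C\<close> in \<open>x1\<close> only.\<close>
  define c where "c = midpoint z x1"
  have dc: "dist c x1 = R / 2" "dist z c = R / 2" by (simp_all add: c_def R_def dist_midpoint)
  have "z \<noteq> x1" using \<open>f z \<noteq> m\<close> x1(1) by (auto simp: C_def)
  then have "R > 0" by (simp add: R_def)
  show False
  proof (rule hopf_touching_ball)
    show "x1 \<in> V" "f x1 = m" using x1(1) assms(1) by (auto simp: C_def)
    show "c \<noteq> x1" using dc(1) \<open>R > 0\<close> by auto
    fix y assume y: "y \<in> cball c (dist c x1)" "y \<noteq> x1"
    have yc: "dist c y \<le> R / 2" using y(1) dc(1) by simp
    have zy: "dist z y \<le> R" using dist_triangle[of z y c] yc dc(2) by linarith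
    have "dist x0 y \<le> dist x0 z + dist z y" by (rule dist_triangle)
    then have y_in: "y \<in> cball x0 \<rho>" using zy R2 z by simp
    then have "y \<in> V" using assms(1) by blast
    moreover have "f y \<noteq> m"
    proof
      assume "f y = m"
      then have "y \<in> C" using y_in by (simp add: C_def)
      then have R_le: "R \<le> dist z y" using x1(2) by (simp add: R_def)
      define a where "a = y - c"
      define d where "d = c - z"
      have norms: "norm a \<le> R / 2" "norm d = R / 2" "norm (a + d) \<ge> R"
        using yc dc(2) R_le by (simp_all add: a_def d_def dist_norm norm_minus_commute)
      \<comment> \<open>The parallelogram law turns equality in the triangle inequality into
        \<open>a = d\<close>: then \<open>y\<close> is the reflection of \<open>z\<close> in
        \<open>c\<close>, which is \<open>x1\<close>.\<close>
      have "norm (a + d) ^ 2 + norm (a - d) ^ 2 = 2 * norm a ^ 2 + 2 * norm d ^ 2"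
        by (simp add: power2_norm_eq_inner inner_simps inner_commute)
      moreover have "norm a ^ 2 \<le> (R / 2) ^ 2" "norm (a + d) ^ 2 \<ge> R ^ 2"
        using norms \<open>R > 0\<close> by (auto intro: power_mono)
      ultimately have "norm (a - d) ^ 2 \<le> 0" using norms(2) by (simp add: power2_eq_square)
      then have "a = d" by simp
      then have "y = 2 *\<^sub>R c - z" by (simp add: a_def d_def scaleR_2 algebra_simps)
      also have "\<dots> = x1" by (simp add: c_def midpoint_def)
      finally show False using y(2) by simp
    qed
    ultimately show "y \<in> V \<and> f y < m" using le by fastforce
  qed
qed

end

section \<open>The time function of a compact stationary submanifold\<close>

lemma fst_sum: "fst (sum f A) = (\<Sum>x\<in>A. fst (f x))"
  by (induction A rule: infinite_finite_induct) auto

lemma smooth_on_fst: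
  assumes "smooth_on S F" "open S"
  shows "smooth_on S (\<lambda>x. fst (F x))"
  using assms unfolding smooth_on_def by (blast intro: Ck_on_linear_compose[OF bounded_linear_fst])

lemma partial_fst:
  assumes "smooth_on S F" "open S" "x \<in> S"
  shows "partial i (\<lambda>x. fst (F x)) x = fst (partial i F x)"
  unfolding partial_def
  by (rule fun_cong[OF frechet_derivative_at[OF has_derivative_fst[OF smooth_on_has_derivative[OF assms]]], symmetric])

lemma partial_partial_fst:
  assumes "smooth_on S F" "open S" "x \<in> S"
  shows "partial i (partial j (\<lambda>x. fst (F x))) x = fst (partial i (partial j F) x)"
proof -
  have "partial i (partial j (\<lambda>x. fst (F x))) x = partial i (\<lambda>x. fst (partial j F x)) x"
    by (rule partial_cong[OF assms(2,3)]) (rule partial_fst[OF assms(1,2)])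
  also have "\<dots> = fst (partial i (partial j F) x)"
    by (rule partial_fst[OF smooth_on_partial[OF assms(1)] assms(2,3)])
  finally show ?thesis .
qed

lemma first_form_vec:
  assumes "smooth_on V F" "open V" "x \<in> V"
  shows "v \<bullet> (first_form F x *v v) = lorentz (frechet_derivative F (at x) v) (frechet_derivative F (at x) v)"
proof -
  have "frechet_derivative F (at x) v = (\<Sum>i\<in>UNIV. v $ i *\<^sub>R partial i F x)"
    unfolding partial_def using smooth_on_has_derivative[OF assms] by (intro linear_axis_expansion has_derivative_linear)
  then show ?thesis
    by (simp add: first_form_def inner_vec_def matrix_vector_mult_def lorentz.sum_left lorentz.sum_right
        lorentz.scaleR_left lorentz.scaleR_right sum_distrib_left mult_ac lorentz_commute)
qed

text \<open>The equation is the vanishing time component of \<open>normal_trace_hessian\<close>,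
  sorted by order of derivatives. In flat space Gamma^k_ij = g^kl <F_ij, F_l>, so the first-order
  coefficients are -g^ij Gamma^k_ij and the operator is the Laplace-Beltrami operator of the induced
  metric.\<close>

lemma elliptic_time:
  fixes F :: "real^'m::finite \<Rightarrow> real \<times> (real^'d)"
  assumes F: "smooth_on V F" and V: "open V"
    and spacelike: "\<And>x v. x \<in> V \<Longrightarrow> v \<noteq> 0 \<Longrightarrow>
      lorentz (frechet_derivative F (at x) v) (frechet_derivative F (at x) v) > 0"
    and harmonic: "\<And>x. x \<in> V \<Longrightarrow> fst (normal_trace_hessian F x) = 0"
    and le: "\<And>x. x \<in> V \<Longrightarrow> fst (F x) \<le> m"
  shows "elliptic_solution V (first_form F)
    (\<lambda>x. \<chi> k. - (\<Sum>l\<in>UNIV. matrix_inv (first_form F x) $ k $ l * lorentz (trace_hessian F x) (partial l F x)))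
    (\<lambda>x. fst (F x)) m"
proof
  have dF: "Ck_on 0 V (partial i F)" and ddF: "Ck_on 0 V (partial i (partial j F))" for i j
    using smooth_on_partial[OF F] smooth_on_partial[OF smooth_on_partial[OF F]] by (simp_all add: smooth_on_def del: Ck_on.simps)
  show pos: "v \<bullet> (first_form F x *v v) > 0" if "x \<in> V" "v \<noteq> 0" for x v
    unfolding first_form_vec[OF F V that(1)] by (rule spacelike[OF that])
  have det: "det (first_form F x) \<noteq> 0" if "x \<in> V" for x
  proof -
    have "v = 0" if "first_form F x *v v = 0" for v using pos[OF \<open>x \<in> V\<close>, of v] that by auto
    then show ?thesis
      by (simp add: invertible_det_nz[symmetric] invertible_left_inverse matrix_left_invertible_ker)
  qed
  have "Ck_on 0 V (\<lambda>x. first_form F x $ i $ j)" for i j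
    unfolding first_form_def by (simp del: Ck_on.simps) (intro Ck_on_bilinear[OF bounded_bilinear_lorentz] V dF)
  then have inv: "Ck_on 0 V (\<lambda>x. matrix_inv (first_form F x) $ i $ j)" for i j
    by (rule Ck_on_matrix_inv[OF V _ det])
  then show "continuous_on V (\<lambda>x. matrix_inv (first_form F x) $ i $ j)" for i j by simp
  have "Ck_on 0 V (trace_hessian F)"
    unfolding trace_hessian_def[abs_def] by (intro Ck_on_sum Ck_on_scaleR V inv ddF)
  then have "Ck_on 0 V (\<lambda>x. (-1) * (\<Sum>l\<in>UNIV. matrix_inv (first_form F x) $ k $ l * lorentz (trace_hessian F x) (partial l F x)))" for k
    by (intro Ck_on_mult Ck_on_sum Ck_on_bilinear[OF bounded_bilinear_lorentz] Ck_on_const V inv dF)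
  then show "continuous_on V (\<lambda>x. (\<chi> k. - (\<Sum>l\<in>UNIV. matrix_inv (first_form F x) $ k $ l * lorentz (trace_hessian F x) (partial l F x))) $ k)" for k
    by simp
  show "transpose (first_form F x) = first_form F x" for x
    by (simp add: transpose_def first_form_def vec_eq_iff lorentz_commute)
  show "smooth_on V (\<lambda>x. fst (F x))" by (rule smooth_on_fst[OF F V])
  show "fst (F x) \<le> m" if "x \<in> V" for x by (rule le[OF that])
  show "(\<Sum>i\<in>UNIV. \<Sum>j\<in>UNIV. matrix_inv (first_form F x) $ i $ j * partial i (partial j (\<lambda>x. fst (F x))) x)
      + (\<Sum>k\<in>UNIV. (\<chi> k. - (\<Sum>l\<in>UNIV. matrix_inv (first_form F x) $ k $ l * lorentz (trace_hessian F x) (partial l F x))) $ k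
        * partial k (\<lambda>x. fst (F x)) x) = 0" if x: "x \<in> V" for x
    using harmonic[OF x]
    \<comment> \<open>\<open>trace_hessian\<close> is unfolded under \<open>fst\<close> only, so
      that it stays folded in the first-order coefficients.\<close>
    by (simp add: normal_trace_hessian_def trace_hessian_def[of F x, THEN arg_cong[of _ _ fst]] partial_fst[OF F V x] partial_partial_fst[OF F V x]
        fst_sum sum_distrib_right sum_negf)
qed (rule V)

text \<open>The set where the time is maximal is closed by continuity, open by
  \<open>constant_near_max\<close> in a chart, and nonempty by compactness; connectedness makes it
  everything.\<close>

lemma constant_fst_of_compact:
  fixes M :: "('a, 'm::finite, 'y) manifold_scheme" and \<psi> :: "'a \<Rightarrow> real \<times> (real^'d::finite)"
  assumes M: "smooth_manifold M" "connected_space (mtop M)" "compact_space (mtop M)"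
    and cont: "continuous_map (mtop M) (top_of_set S) \<psi>"
    and smooth: "\<And>c. c \<in> atlas M \<Longrightarrow> smooth_on (snd c ` fst c) (\<psi> \<circ> param c)"
    and spacelike: "\<And>c x v. c \<in> atlas M \<Longrightarrow> x \<in> snd c ` fst c \<Longrightarrow> v \<noteq> 0 \<Longrightarrow>
      lorentz (frechet_derivative (\<psi> \<circ> param c) (at x) v) (frechet_derivative (\<psi> \<circ> param c) (at x) v) > 0"
    and harmonic: "\<And>c x. c \<in> atlas M \<Longrightarrow> x \<in> snd c ` fst c \<Longrightarrow> fst (normal_trace_hessian (\<psi> \<circ> param c) x) = 0"
  shows "\<exists>t0. \<forall>p\<in>topspace (mtop M). fst (\<psi> p) = t0"
\<comment> \<open>\<open>smooth_manifold\<close> admits the empty manifold, on which no maximum is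
  attained.\<close>
proof (cases "topspace (mtop M) = {}")
  case False
  have "continuous_map (mtop M) euclidean \<psi>" using cont continuous_map_into_fulltopology by blast
  then have cont_t: "continuous_map (mtop M) euclideanreal (\<lambda>p. fst (\<psi> p))"
  proof -
    have "continuous_map euclidean euclideanreal (fst :: real \<times> (real^'d) \<Rightarrow> real)"
      by (simp add: continuous_on_fst)
    from continuous_map_compose[OF \<open>continuous_map (mtop M) euclidean \<psi>\<close> this] show ?thesis
      by (simp add: o_def)
  qed
  have "compactin euclideanreal ((\<lambda>p. fst (\<psi> p)) ` topspace (mtop M))"
    using image_compactin[OF _ cont_t] M(3) by (simp add: compact_space_def)
  then have "compact ((\<lambda>p. fst (\<psi> p)) ` topspace (mtop M))" by simp
  then obtain m where m: "m \<in> (\<lambda>p. fst (\<psi> p)) ` topspace (mtop M)"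
      "\<And>p. p \<in> topspace (mtop M) \<Longrightarrow> fst (\<psi> p) \<le> m"
    using compact_attains_sup[of "(\<lambda>p. fst (\<psi> p)) ` topspace (mtop M)"] False by auto
  define C where "C = {p \<in> topspace (mtop M). fst (\<psi> p) = m}"
  have "closedin (mtop M) C"
    using closedin_continuous_map_preimage[OF cont_t, of "{m}"] by (simp add: C_def)
  moreover have "openin (mtop M) C"
  proof (subst openin_subopen, intro ballI)
    fix p assume p: "p \<in> C"
    then obtain c where c: "c \<in> atlas M" "p \<in> fst c"
      using M(1) unfolding smooth_manifold_def C_def by blast
    have c_open: "openin (mtop M) (fst c)" and V: "open (snd c ` fst c)"
      and homeo: "homeomorphic_map (subtopology (mtop M) (fst c)) (top_of_set (snd c ` fst c)) (snd c)"
      using M(1) c(1) unfolding smooth_manifold_def by blast+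
    have sub: "fst c \<subseteq> topspace (mtop M)" by (rule openin_subset[OF c_open])
    have param_c: "param c (snd c q) = q" if "q \<in> fst c" for q
      using homeomorphic_imp_injective_map[OF homeo] sub that by (simp add: param_def Int_absorb1)
    interpret elliptic_solution "snd c ` fst c" "first_form (\<psi> \<circ> param c)"
      "\<lambda>x. \<chi> k. - (\<Sum>l\<in>UNIV. matrix_inv (first_form (\<psi> \<circ> param c) x) $ k $ l *
          lorentz (trace_hessian (\<psi> \<circ> param c) x) (partial l (\<psi> \<circ> param c) x))"
      "\<lambda>x. fst ((\<psi> \<circ> param c) x)" m
    proof (rule elliptic_time[OF smooth[OF c(1)] V spacelike[OF c(1)] harmonic[OF c(1)]])
      fix x assume "x \<in> snd c ` fst c"
      from subsetD[OF sub param_in[OF this]] have "fst (\<psi> (param c x)) \<le> m" by (rule m(2))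
      then show "fst ((\<psi> \<circ> param c) x) \<le> m" by simp
    qed
    obtain \<rho> where \<rho>: "\<rho> > 0" "cball (snd c p) \<rho> \<subseteq> snd c ` fst c"
      using V c(2) open_contains_cball by blast
    have const: "fst (\<psi> (param c z)) = m" if "z \<in> ball (snd c p) (\<rho> / 2)" for z
      using constant_near_max[OF \<rho>(2,1) _ that] p param_c[OF c(2)] by (simp add: C_def)
    let ?T = "{q \<in> topspace (subtopology (mtop M) (fst c)). snd c q \<in> snd c ` fst c \<inter> ball (snd c p) (\<rho> / 2)}"
    have "openin (top_of_set (snd c ` fst c)) (snd c ` fst c \<inter> ball (snd c p) (\<rho> / 2))"
      by (rule openin_open_Int) simp
    then have "openin (subtopology (mtop M) (fst c)) ?T"
      using homeomorphic_imp_continuous_map[OF homeo] by (rule openin_continuous_map_preimage[rotated])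
    then have "openin (mtop M) ?T" using c_open by (meson openin_trans_full)
    moreover have "p \<in> ?T" using c(2) sub \<rho>(1) by auto
    moreover have "?T \<subseteq> C"
    proof
      fix q assume q: "q \<in> ?T"
      then have "q \<in> fst c" "snd c q \<in> ball (snd c p) (\<rho> / 2)" by auto
      then show "q \<in> C" using const[of "snd c q"] param_c sub by (auto simp: C_def)
    qed
    ultimately show "\<exists>T. openin (mtop M) T \<and> p \<in> T \<and> T \<subseteq> C" by blast
  qed
  ultimately have "C = {} \<or> C = topspace (mtop M)" using M(2) connected_space_clopen_in by blast
  moreover have "C \<noteq> {}" using m(1) by (auto simp: C_def)
  ultimately show ?thesis unfolding C_def by blast
qed simp

theorem mainTheorem4:
  fixes M :: "('a, 'm::finite) manifold"
    and \<psi> :: "'a \<Rightarrow> real \<times> (real^'d::finite)"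
  assumes dim: "CARD('d) = CARD('n::finite) + 1"
    and manifold: "smooth_manifold M" "connected_space (mtop M)"
    and compact: "compact_space (mtop M)"
  shows "spacelike_submanifold M (static_einstein :: (real \<times> (real^'d), 'd) semi_riemannian) \<psi> \<and>
         stationary M (static_einstein :: (real \<times> (real^'d), 'd) semi_riemannian) \<psi>
     \<longleftrightarrow> (\<exists>t0. immersion M (slice t0 :: (real \<times> (real^'d), 'n) semi_riemannian) \<psi> \<and>
               stationary M (slice t0 :: (real \<times> (real^'d), 'n) semi_riemannian) \<psi>)"
proof -
  let ?E = "static_einstein :: (real \<times> (real^'d), 'd) semi_riemannian"
  let ?S = "\<lambda>t0. slice t0 :: (real \<times> (real^'d), 'n) semi_riemannian"
  let ?F = "\<lambda>c. \<psi> \<circ> param c"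
  interpret E: map_to_submanifold M cylinder cylinder_tangent ?E \<psi>
    by (rule map_to_cylinder[OF manifold(1)])
  \<comment> \<open>Kept for arbitrary \<open>t0\<close>, as the height of the slice emerges only
    once the time is known to be constant.\<close>
  interpret S: map_to_submanifold M "slice_set t0" slice_tangent "?S t0" \<psi> for t0
    by (rule map_to_slice[OF dim manifold(1)])
  have slice_sub: "slice_set t0 \<subseteq> cylinder" for t0 :: real by (auto simp: slice_set_def cylinder_def)
  show ?thesis
  proof
    assume L: "spacelike_submanifold M ?E \<psi> \<and> stationary M ?E \<psi>"
    then have imm: "immersion M ?E \<psi>" by (simp add: spacelike_submanifold_def)
    have cont: "continuous_map (mtop M) (top_of_set cylinder) \<psi>"
      and smooth: "\<And>c. c \<in> atlas M \<Longrightarrow> smooth_on (snd c ` fst c) (?F c)"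
      and inj: "\<And>c x. c \<in> atlas M \<Longrightarrow> x \<in> snd c ` fst c \<Longrightarrow> inj (frechet_derivative (?F c) (at x))"
      using imm[unfolded E.immersion_iff] by blast+
    have spacelike: "\<And>c x v. c \<in> atlas M \<Longrightarrow> x \<in> snd c ` fst c \<Longrightarrow> v \<noteq> 0 \<Longrightarrow>
        lorentz (frechet_derivative (?F c) (at x) v) (frechet_derivative (?F c) (at x) v) > 0"
      using L[unfolded E.spacelike_submanifold_iff] by blast
    have stat: "\<And>c x w. c \<in> atlas M \<Longrightarrow> x \<in> snd c ` fst c \<Longrightarrow> w \<in> cylinder_tangent (\<psi> (param c x)) \<Longrightarrow>
        lorentz (normal_trace_hessian (?F c) x) w = 0"
      using L E.stationary_iff[OF imm] by blast
    have "fst (normal_trace_hessian (?F c) x) = 0" if "c \<in> atlas M" "x \<in> snd c ` fst c" for c x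
      using stat[OF that, of "(1, 0)"] by (simp add: cylinder_tangent_def lorentz_def)
    from constant_fst_of_compact[OF manifold compact cont smooth spacelike this]
    obtain t0 where t0: "\<And>p. p \<in> topspace (mtop M) \<Longrightarrow> fst (\<psi> p) = t0" by blast
    have "\<psi> ` topspace (mtop M) \<subseteq> slice_set t0"
      using t0 cont by (auto simp: continuous_map_in_subtopology slice_set_def cylinder_def)
    then have "continuous_map (mtop M) (top_of_set (slice_set t0)) \<psi>"
      using cont by (auto simp: continuous_map_in_subtopology)
    then have S_imm: "immersion M (?S t0) \<psi>"
      unfolding S.immersion_iff using smooth inj by blast
    \<comment> \<open>The slice has fewer tangent vectors to test with, so stationarity in Q(1)
      passes to it.\<close>
    have "slice_tangent p \<subseteq> cylinder_tangent p" for p :: "real \<times> (real^'d)"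
      by (auto simp: slice_tangent_def cylinder_tangent_def)
    then have "stationary M (?S t0) \<psi>"
      unfolding S.stationary_iff[OF S_imm] using stat by blast
    then show "\<exists>t0. immersion M (?S t0) \<psi> \<and> stationary M (?S t0) \<psi>" using S_imm by blast
  next
    assume "\<exists>t0. immersion M (?S t0) \<psi> \<and> stationary M (?S t0) \<psi>"
    then obtain t0 where imm: "immersion M (?S t0) \<psi>" and stat: "stationary M (?S t0) \<psi>" by blast
    have cont: "continuous_map (mtop M) (top_of_set (slice_set t0)) \<psi>"
      and smooth: "\<And>c. c \<in> atlas M \<Longrightarrow> smooth_on (snd c ` fst c) (?F c)"
      and inj: "\<And>c x. c \<in> atlas M \<Longrightarrow> x \<in> snd c ` fst c \<Longrightarrow> inj (frechet_derivative (?F c) (at x))"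
      using imm[unfolded S.immersion_iff] by blast+
    have "continuous_map (mtop M) (top_of_set cylinder) \<psi>"
      using cont slice_sub[of t0] by (auto simp: continuous_map_in_subtopology)
    then have E_imm: "immersion M ?E \<psi>" unfolding E.immersion_iff using smooth inj by blast
    have fst_D: "fst (frechet_derivative (?F c) (at x) v) = 0"
      if c: "c \<in> atlas M" and x: "x \<in> snd c ` fst c" for c x v
    proof -
      note F' = has_derivative_fst[OF smooth_on_has_derivative[OF smooth[OF c] E.open_V[OF c] x]]
      have "fst (?F c y) = t0" if "y \<in> snd c ` fst c" for y
        using S.F_in_S[OF cont c that] by (simp add: slice_set_def)
      then have "((\<lambda>y. t0) has_derivative (\<lambda>v. fst (frechet_derivative (?F c) (at x) v))) (at x)"
        by (rule has_derivative_transform_within_open[OF F' E.open_V[OF c] x])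
      then have "(\<lambda>v. fst (frechet_derivative (?F c) (at x) v)) = (\<lambda>v. 0)"
        using has_derivative_unique has_derivative_const by blast
      then show ?thesis by meson
    qed
    have fst_partial: "fst (partial i (?F c) x) = 0" if "c \<in> atlas M" "x \<in> snd c ` fst c" for c x i
      using fst_D[OF that] by (simp add: partial_def)
    have fst_partial2: "fst (partial i (partial j (?F c)) x) = 0" if c: "c \<in> atlas M" and x: "x \<in> snd c ` fst c" for c x i j
    proof -
      have "fst (partial i (partial j (?F c)) x) = partial i (\<lambda>x. fst (partial j (?F c) x)) x"
        by (rule partial_fst[OF smooth_on_partial[OF smooth[OF c]] E.open_V[OF c] x, symmetric])
      also have "\<dots> = partial i (\<lambda>x. 0) x"
        by (rule partial_cong[OF E.open_V[OF c] x]) (rule fst_partial[OF c])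
      also have "\<dots> = 0" by (simp add: partial_def)
      finally show ?thesis .
    qed
    have fst_H: "fst (normal_trace_hessian (?F c) x) = 0" if "c \<in> atlas M" "x \<in> snd c ` fst c" for c x
      by (simp add: normal_trace_hessian_def trace_hessian_def fst_sum fst_partial[OF that] fst_partial2[OF that])
    \<comment> \<open>Without time component the Lorentz product is Euclidean, so injectivity of the
      derivative gives positivity.\<close>
    have "lorentz (frechet_derivative (?F c) (at x) v) (frechet_derivative (?F c) (at x) v) > 0"
      if c: "c \<in> atlas M" and x: "x \<in> snd c ` fst c" and "v \<noteq> 0" for c x v
    proof -
      have lin: "linear (frechet_derivative (?F c) (at x))"
        by (rule has_derivative_linear[OF smooth_on_has_derivative[OF smooth[OF c] E.open_V[OF c] x]])
      have "frechet_derivative (?F c) (at x) v \<noteq> 0"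
        using inj[OF c x] \<open>v \<noteq> 0\<close> linear_injective_0[OF lin] by blast
      then show ?thesis using fst_D[OF c x, of v] by (simp add: lorentz_def prod_eq_iff)
    qed
    then have "spacelike_submanifold M ?E \<psi>"
      unfolding E.spacelike_submanifold_iff using E_imm by blast
    moreover have "lorentz (normal_trace_hessian (?F c) x) w = 0"
      if c: "c \<in> atlas M" and x: "x \<in> snd c ` fst c" and w: "w \<in> cylinder_tangent (\<psi> (param c x))" for c x w
    proof -
      \<comment> \<open>Dropping the time component of \<open>w\<close> makes it tangent to the
        slice and leaves the pairing unchanged by \<open>fst_H\<close>.\<close>
      have "(0, snd w) \<in> slice_tangent (\<psi> (param c x))"
        using w by (simp add: slice_tangent_def cylinder_tangent_def)
      then have "lorentz (normal_trace_hessian (?F c) x) (0, snd w) = 0"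
        using stat[unfolded S.stationary_iff[OF imm]] c x by blast
      then show ?thesis using fst_H[OF c x] by (simp add: lorentz_def)
    qed
    then have "stationary M ?E \<psi>" unfolding E.stationary_iff[OF E_imm] by blast
    ultimately show "spacelike_submanifold M ?E \<psi> \<and> stationary M ?E \<psi>" ..
  qed
qed

end
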